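(* Let $\Psi(z_1,z_2) = \phi(z_1)\psi(z_2)$, $(z_1,z_2) \in \mathbb{D}^2$, for one-variable inner functions $\phi$ and $\psi$ on $\mathbb{D}$, such that (A) $\psi$ extends to be continuously differentiable on $\mathbb{T}$ except at a finite set of points; (B) the solutions to $\psi^* = \beta$ for $\beta \in \mathbb{T}$ can be parameterized by functions $\{g_k(\beta)\}_{k \ge 1}$ which are continuous in $\beta$ on $\mathbb{T}$ except at a finite set of points; (C) for every $\beta \in \mathbb{T}$, there are no solutions to $\psi^* = \beta$ with infinite multiplicity; and (D) the Clark measures of $\psi$ are all discrete. Then the Clark measures $\sigma_\alpha$, $\alpha \in \mathbb{T}$, of $\Psi$ satisfy $$\int_{\mathbb{T}^2} f(\xi)\, d\sigma_\alpha(\xi) = \sum_{k \ge 1} \int_{\mathbb{T}} f\big(\zeta, g_k(\alpha \overline{\phi^*(\zeta)})\big)\, \frac{dm(\zeta)}{|\psi'(g_k(\alpha\overline{\phi^*(\zeta)}))|}$$ for $f \in C(\mathbb{T}^2)$.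
   Context: $\mathbb{D}^d = \{z \in \mathbb{C}^d : |z_j| < 1,\ j=1,\dots,d\}$ and $\mathbb{T}^d = \{\zeta \in \mathbb{C}^d : |\zeta_j| = 1,\ j=1,\dots,d\}$, with $\mathbb{D}=\mathbb{D}^1$ and $\mathbb{T}=\mathbb{T}^1$; $m_d$ is normalized Lebesgue measure on $\mathbb{T}^d$ and $m = m_1$. $C(\mathbb{T}^2)$ is the space of continuous functions on $\mathbb{T}^2$. A bounded holomorphic function $\phi : \mathbb{D}^d \to \mathbb{D}$ is inner if its non-tangential boundary values $\phi^*(\zeta)$, which exist for $m_d$-almost every $\zeta \in \mathbb{T}^d$, satisfy $|\phi^*(\zeta)| = 1$ for $m_d$-almost every $\zeta \in \mathbb{T}^d$. The product $\phi(z_1)\psi(z_2)$ of one-variable inner functions is inner on $\mathbb{D}^2$. The quantity $\alpha\overline{\phi^*(\zeta)}$ is a well-defined point of $\mathbb{T}$ for $m$-almost every $\zeta\in\mathbb{T}$. The Poisson kernel is $P(z,\zeta) = \prod_{j=1}^d \frac{1-|z_j|^2}{|\zeta_j - z_j|^2}$ for $z \in \mathbb{D}^d$, $\zeta \in \mathbb{T}^d$. For an inner function $\phi$ on $\mathbb{D}^d$ and $\alpha \in \mathbb{T}$, the Clark measure of $\phi$ associated to $\alpha$ is the unique positive Borel measure $\sigma_\alpha$ on $\mathbb{T}^d$ with $$\frac{1-|\phi(z)|^2}{|\alpha - \phi(z)|^2} = \int_{\mathbb{T}^d} P(z,\zeta)\, d\sigma_\alpha(\zeta), \quad z \in \mathbb{D}^d.$$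 A Clark measure on $\mathbb{T}$ is discrete if it consists of (countably many) point masses. For $\eta \in \mathbb{T}$ and an inner function $\psi$ on $\mathbb{D}$, $\psi'(\eta)$ denotes the angular derivative, i.e. the non-tangential limit of $(\psi(z)-\psi^*(\eta))/(z-\eta)$ as $z \to \eta$, where $\psi^*(\eta)$ is the non-tangential limit of $\psi$ at $\eta$. (Known fact: the Clark measure of $\psi$ associated to $\beta \in \mathbb{T}$ has a point mass at $\eta$ if and only if $\psi^*(\eta) = \beta$ and $\psi$ has a finite angular derivative at $\eta$, in which case the mass equals $1/|\psi'(\eta)|$.) *)

theory Defs
  imports "HOL-Analysis.Analysis"
begin

abbreviation disc :: "complex set" where
  "disc \<equiv> ball 0 1"

abbreviation circle :: "complex set" where
  "circle \<equiv> sphere 0 1"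

text \<open>
  The completion matters: boundary functions are only determined almost everywhere, so functions
  composed with them are in general Lebesgue measurable but not Borel measurable.
\<close>

definition circle_measure :: "complex measure" where
  "circle_measure =
     completion (distr (uniform_measure lborel {0..<2 * pi}) (restrict_space borel circle) cis)"

text \<open>
  A limit along \<open>nontangential \<zeta>\<close> is a limit within every Stolz region with vertex \<open>\<zeta>\<close>.
\<close>

definition stolz_region :: "real \<Rightarrow> complex \<Rightarrow> complex set" where
  "stolz_region \<kappa> \<zeta> = {z \<in> disc. norm (z - \<zeta>) < \<kappa> * (1 - norm z)}"

definition nontangential :: "complex \<Rightarrow> complex filter" where
  "nontangential \<zeta> = (SUP \<kappa>\<in>{1<..}. at \<zeta> within stolz_region \<kappa> \<zeta>)"

text \<open>
  The values of \<open>boundary_value\<close> and \<open>angular_deriv\<close> are meaningful only where the respective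
  limit exists.
\<close>

definition boundary_value :: "(complex \<Rightarrow> complex) \<Rightarrow> complex \<Rightarrow> complex" where
  "boundary_value \<phi> \<zeta> = Lim (nontangential \<zeta>) \<phi>"

definition angular_deriv :: "(complex \<Rightarrow> complex) \<Rightarrow> complex \<Rightarrow> complex" where
  "angular_deriv \<psi> \<eta> =
     Lim (nontangential \<eta>) (\<lambda>z. (\<psi> z - boundary_value \<psi> \<eta>) / (z - \<eta>))"

definition inner_function :: "(complex \<Rightarrow> complex) \<Rightarrow> bool" where
  "inner_function \<phi> \<longleftrightarrow>
     \<phi> holomorphic_on disc \<and> \<phi> ` disc \<subseteq> disc \<and>
     (AE \<zeta> in circle_measure. \<exists>w. (\<phi> \<longlongrightarrow> w) (nontangential \<zeta>) \<and> norm w = 1)"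

definition poisson_kernel :: "complex \<Rightarrow> complex \<Rightarrow> real" where
  "poisson_kernel z \<zeta> = (1 - (norm z)\<^sup>2) / (norm (\<zeta> - z))\<^sup>2"

definition poisson_kernel2 :: "complex \<times> complex \<Rightarrow> complex \<times> complex \<Rightarrow> real" where
  "poisson_kernel2 z \<zeta> = poisson_kernel (fst z) (fst \<zeta>) * poisson_kernel (snd z) (snd \<zeta>)"

text \<open>
  The left-hand sides below are positive when \<open>\<phi>\<close> maps into the disc, so the Poisson kernels are
  then integrable (a non-integrable function has integral 0), and \<open>z = 0\<close> shows that \<open>\<sigma>\<close> is finite.
\<close>

definition is_clark_measure :: "(complex \<Rightarrow> complex) \<Rightarrow> complex \<Rightarrow> complex measure \<Rightarrow> bool" where
  "is_clark_measure \<phi> \<alpha> \<sigma> \<longleftrightarrow>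
     space \<sigma> = circle \<and> sets \<sigma> = sets (restrict_space borel circle) \<and>
     (\<forall>z\<in>disc. (1 - (norm (\<phi> z))\<^sup>2) / (norm (\<alpha> - \<phi> z))\<^sup>2 = (LINT \<zeta>|\<sigma>. poisson_kernel z \<zeta>))"

definition is_clark_measure2 ::
  "(complex \<times> complex \<Rightarrow> complex) \<Rightarrow> complex \<Rightarrow> (complex \<times> complex) measure \<Rightarrow> bool" where
  "is_clark_measure2 \<Phi> \<alpha> \<sigma> \<longleftrightarrow>
     space \<sigma> = circle \<times> circle \<and> sets \<sigma> = sets (restrict_space borel (circle \<times> circle)) \<and>
     (\<forall>z\<in>disc \<times> disc.
        (1 - (norm (\<Phi> z))\<^sup>2) / (norm (\<alpha> - \<Phi> z))\<^sup>2 = (LINT \<zeta>|\<sigma>. poisson_kernel2 z \<zeta>))"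

definition discrete_measure :: "'a measure \<Rightarrow> bool" where
  "discrete_measure \<sigma> \<longleftrightarrow>
     (\<exists>S c. countable S \<and> S \<subseteq> space \<sigma> \<and>
        (\<forall>A\<in>sets \<sigma>. emeasure \<sigma> A = (\<integral>\<^sup>+ s. c s * indicator A s \<partial>count_space S)))"

definition C1_on_circle_except_finite :: "(complex \<Rightarrow> complex) \<Rightarrow> bool" where
  "C1_on_circle_except_finite \<psi> \<longleftrightarrow>
     (\<exists>E F F'. finite E \<and> E \<subseteq> circle \<and> (\<forall>z\<in>disc. F z = \<psi> z) \<and>
        (\<forall>z\<in>cball 0 1 - E. (F has_field_derivative F' z) (at z within cball 0 1 - E)) \<and>
        continuous_on (cball 0 1 - E) F')"

definition boundary_solutions :: "(complex \<Rightarrow> complex) \<Rightarrow> complex \<Rightarrow> complex set" where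
  "boundary_solutions \<psi> \<beta> = {\<eta> \<in> circle. (\<psi> \<longlongrightarrow> \<beta>) (nontangential \<eta>)}"

text \<open>
  The index set \<open>K\<close> may be finite (finite Blaschke products) or infinite. The branches list every
  solution; different branches may take the same value only for finitely many \<open>\<beta>\<close>. (Without such
  a condition one branch could be listed twice and a sum over the branches would count it twice.)
\<close>

definition parametrizes_solutions ::
  "(complex \<Rightarrow> complex) \<Rightarrow> nat set \<Rightarrow> (nat \<Rightarrow> complex \<Rightarrow> complex) \<Rightarrow> bool" where
  "parametrizes_solutions \<psi> K g \<longleftrightarrow>
     (\<forall>\<beta>\<in>circle. (\<lambda>k. g k \<beta>) ` K = boundary_solutions \<psi> \<beta>) \<and>
     (\<exists>E. finite E \<and> (\<forall>\<beta>\<in>circle - E. inj_on (\<lambda>k. g k \<beta>) K)) \<and>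
     (\<forall>k\<in>K. \<exists>E. finite E \<and> continuous_on (circle - E) (g k))"

text \<open>
  The multiplicity of a solution \<open>\<eta>\<close> is the number of branches passing through it. (As the order of
  a zero it would be 1 wherever \<open>\<psi>\<close> is differentiable at \<open>\<eta>\<close>, because the angular derivative of an
  inner function never vanishes.)
\<close>

definition infinite_multiplicity ::
  "nat set \<Rightarrow> (nat \<Rightarrow> complex \<Rightarrow> complex) \<Rightarrow> complex \<Rightarrow> complex \<Rightarrow> bool" where
  "infinite_multiplicity K g \<beta> \<eta> \<longleftrightarrow> infinite {k \<in> K. g k \<beta> = \<eta>}"

end

theory Submission
  imports Defs "HOL-Complex_Analysis.Cauchy_Integral_Formula"
begin

text \<open>
  For fixed \<open>z\<^sub>2\<close>, the quotient defining the Clark measure of \<open>\<Psi>\<close> is, as a function of \<open>z\<^sub>1\<close>, the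
  Poisson integral of its boundary values, and these are the quotients for \<open>\<psi>\<close> and
  \<open>\<beta> = \<alpha> cnj (\<phi>\<^sup>* \<zeta>)\<close> at \<open>z\<^sub>2\<close>. Each of them is a sum of Poisson kernels over the atoms of the
  discrete Clark measure of \<open>\<psi>\<close>; outside finitely many \<open>\<beta>\<close> the atoms are the branches
  \<open>g k \<beta>\<close> with masses \<open>1 / \<bar>\<psi>' (g k \<beta>)\<bar>\<close>, and almost every \<open>\<zeta>\<close> avoids the exceptional \<open>\<beta>\<close>.
  So the measure given by the right-hand side has the same Poisson integrals as the Clark measure
  of \<open>\<Psi>\<close>, and Poisson integrals determine the integrals of continuous functions.
\<close>

section \<open>Integration on the circle\<close>

text \<open>The obstacle is that boundary values, branches and angular derivatives are under control
  only almost everywhere. All integration therefore uses the Borel measure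
  \<open>arc_measure\<close> and a Borel representative \<open>b\<close> of the boundary values of
  \<phi>, built from radial limits; the completion \<open>circle_measure\<close> enters only at the
  end, where changes on a null set are harmless. The Poisson formula is derived from Cauchy's
  formula, hence for holomorphic functions. It reaches the Clark quotient because that is the real
  part of (\<alpha> + w c) / (\<alpha> - w c) with w = \<phi>(z1) and c = \<psi>(z2), which is
  holomorphic in w past the closed disc as |c| < 1. The masses of the atoms are computed: a radial
  limit of the Clark quotient isolates an atom, and (A) evaluates the same limit through the
  derivative. That this derivative is nonzero is read off from the Clark measure of the antipodal
  value -\<beta>. Poisson integrals are handled as nonnegative integrals, so sum and integral can be
  exchanged before anything is known to be finite; finiteness then comes from z = 0.\<close>

definition arc_measure :: "complex measure" where
  "arc_measure = distr (uniform_measure lborel {0..<2 * pi}) (restrict_space borel circle) cis"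

lemma circle_measure_eq: "circle_measure = completion arc_measure"
  by (simp add: circle_measure_def arc_measure_def)

lemma space_arc_measure [simp]: "space arc_measure = circle"
  and sets_arc_measure [measurable_cong]: "sets arc_measure = sets (restrict_space borel circle)"
  by (simp_all add: arc_measure_def space_restrict_space)

lemma cis_measurable_circle: "cis \<in> borel \<rightarrow>\<^sub>M restrict_space borel circle"
  by (intro measurable_restrict_space2 borel_measurable_continuous_onI continuous_intros) auto

lemma emeasure_arc_measure_circle: "emeasure arc_measure circle = 1"
proof -
  have "emeasure arc_measure circle = emeasure (uniform_measure lborel {0..<2 * pi}) UNIV"
    unfolding arc_measure_def using cis_measurable_circle
    by (subst emeasure_distr) (auto simp: space_restrict_space sets_restrict_space vimage_def)
  also have "\<dots> = emeasure lborel {0..<2*pi} / emeasure lborel {0..<2*pi}"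
    by (subst emeasure_uniform_measure) auto
  also have "\<dots> = 1"
    by (auto intro!: ennreal_divide_self)
  finally show ?thesis .
qed

text \<open>Under these assumptions every continuous function on the space is measurable and
  integrable. Asking for a measurable identity, instead of fixing the sigma-algebra, lets products
  qualify without identifying their sigma-algebra. The circle, the torus and all Clark measures are
  instances.\<close>

locale compact_borel_measure = finite_measure M for M :: "'a::topological_space measure" +
  assumes compact_space: "compact (space M)"
    and id_borel_measurable: "(\<lambda>x. x) \<in> borel_measurable M"
begin

lemma continuous_on_imp_measurable:
  fixes h :: "'a \<Rightarrow> 'b::topological_space"
  assumes "continuous_on (space M) h"
  shows "h \<in> borel_measurable M"
  by (rule measurable_compose[OF measurable_restrict_space2
        borel_measurable_continuous_on_restrict[OF assms]])
    (use id_borel_measurable in auto)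

lemma continuous_on_imp_integrable:
  fixes h :: "'a \<Rightarrow> 'b::{banach, second_countable_topology}"
  assumes "continuous_on (space M) h"
  shows "integrable M h"
proof -
  have "bounded (h ` space M)"
    by (intro compact_imp_bounded compact_continuous_image assms compact_space)
  then obtain B where "\<And>x. x \<in> space M \<Longrightarrow> norm (h x) \<le> B"
    unfolding bounded_iff by blast
  then show ?thesis
    by (intro integrable_const_bound[of _ B] continuous_on_imp_measurable assms AE_I2) auto
qed

end

lemma compact_borel_measureI:
  assumes "finite_measure M" "sets M = sets (restrict_space borel A)" "compact A"
  shows "compact_borel_measure M" "space M = A"
proof -
  interpret finite_measure M by fact
  show sp: "space M = A"
    using sets_eq_imp_space_eq[OF assms(2)] by (simp add: space_restrict_space)
  have "(\<lambda>x. x) \<in> borel_measurable M"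
    unfolding measurable_cong_sets[OF assms(2) refl] by (rule measurable_restrict_space1) simp
  with sp assms(3) show "compact_borel_measure M"
    by unfold_locales simp_all
qed

text \<open>Second countability makes the product of the Borel sigma-algebras the Borel
  sigma-algebra of the product, which is what measurability of the identity needs.\<close>

lemma compact_borel_measure_pair:
  fixes M :: "'a::second_countable_topology measure" and N :: "'b::second_countable_topology measure"
  assumes "compact_borel_measure M" "compact_borel_measure N"
  shows "compact_borel_measure (M \<Otimes>\<^sub>M N)"
proof -
  interpret M: compact_borel_measure M by fact
  interpret N: compact_borel_measure N by fact
  have "emeasure (M \<Otimes>\<^sub>M N) (space (M \<Otimes>\<^sub>M N)) \<noteq> \<infinity>"
    by (simp add: space_pair_measure N.emeasure_pair_measure_Times ennreal_mult_eq_top_iff)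
  then interpret finite_measure "M \<Otimes>\<^sub>M N"
    by (rule finite_measureI)
  show ?thesis
  proof
    show "compact (space (M \<Otimes>\<^sub>M N))"
      by (simp add: space_pair_measure compact_Times M.compact_space N.compact_space)
    have [measurable]: "fst \<in> M \<Otimes>\<^sub>M N \<rightarrow>\<^sub>M borel" "snd \<in> M \<Otimes>\<^sub>M N \<rightarrow>\<^sub>M borel"
      by (rule measurable_compose[OF measurable_fst M.id_borel_measurable]
          measurable_compose[OF measurable_snd N.id_borel_measurable])+
    have "(\<lambda>x. (fst x, snd x)) \<in> M \<Otimes>\<^sub>M N \<rightarrow>\<^sub>M borel \<Otimes>\<^sub>M borel"
      by measurable
    then show "(\<lambda>x. x) \<in> borel_measurable (M \<Otimes>\<^sub>M N)"
      by (simp add: borel_prod)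
  qed
qed

lemma Fubini_continuous_compact:
  fixes M :: "'a::second_countable_topology measure" and N :: "'b::second_countable_topology measure"
    and h :: "'a \<Rightarrow> 'b \<Rightarrow> 'c::{banach, second_countable_topology}"
  assumes M: "compact_borel_measure M" and N: "compact_borel_measure N"
    and h: "continuous_on (space M \<times> space N) (\<lambda>x. h (fst x) (snd x))"
  shows "(LINT x|M. LINT y|N. h x y) = (LINT x|(M \<Otimes>\<^sub>M N). h (fst x) (snd x))"
    and "(LINT x|M. LINT y|N. h x y) = (LINT y|N. LINT x|M. h x y)"
proof -
  interpret M: compact_borel_measure M by fact
  interpret N: compact_borel_measure N by fact
  interpret MN: compact_borel_measure "M \<Otimes>\<^sub>M N"
    by (rule compact_borel_measure_pair[OF M N])
  interpret P: pair_sigma_finite M N ..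
  have "integrable (M \<Otimes>\<^sub>M N) (\<lambda>x. h (fst x) (snd x))"
    using h by (intro MN.continuous_on_imp_integrable) (simp add: space_pair_measure)
  then have int: "integrable (M \<Otimes>\<^sub>M N) (case_prod h)"
    by (simp add: case_prod_beta')
  show "(LINT x|M. LINT y|N. h x y) = (LINT x|(M \<Otimes>\<^sub>M N). h (fst x) (snd x))"
    using P.integral_fst[OF int] by (simp add: case_prod_beta')
  show "(LINT x|M. LINT y|N. h x y) = (LINT y|N. LINT x|M. h x y)"
    using P.Fubini_integral[OF int] by simp
qed

interpretation arc: compact_borel_measure arc_measure
  by (rule compact_borel_measureI(1)[OF finite_measureI sets_arc_measure])
    (simp_all add: emeasure_arc_measure_circle)

lemma continuous_on_imp_measurable_arc:
  fixes h :: "complex \<Rightarrow> 'a::topological_space"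
  shows "continuous_on circle h \<Longrightarrow> h \<in> borel_measurable arc_measure"
  using arc.continuous_on_imp_measurable by simp

lemma continuous_on_imp_integrable_arc:
  fixes h :: "complex \<Rightarrow> 'a::{banach, second_countable_topology}"
  shows "continuous_on circle h \<Longrightarrow> integrable arc_measure h"
  using arc.continuous_on_imp_integrable by simp

text \<open>The bridge from the Lebesgue integral against \<open>arc_measure\<close> to the integral
  over the parameter interval in which contour integrals are expressed.\<close>

lemma integral_arc_measure:
  fixes h :: "complex \<Rightarrow> complex"
  assumes "continuous_on circle h"
  shows "(LINT \<zeta>|arc_measure. h \<zeta>) = integral {0..2 * pi} (\<lambda>t. h (cis t)) / (2 * pi)"
proof -
  have hcis: "continuous_on A (\<lambda>t. h (cis t))" for A
    by (rule continuous_on_compose2[OF assms]) (auto intro!: continuous_intros)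
  have hm [measurable]: "(\<lambda>t. h (cis t)) \<in> borel_measurable borel"
    by (rule borel_measurable_continuous_onI[OF hcis])
  have um: "uniform_measure lborel {0..<2 * pi} =
      density lborel (\<lambda>x. ennreal (indicator {0..<2 * pi} x / (2 * pi)))"
    unfolding uniform_measure_def
    by (intro density_cong) (auto simp: divide_ennreal ennreal_indicator[symmetric] split: split_indicator)
  have "(LINT \<zeta>|arc_measure. h \<zeta>) = (LINT t|uniform_measure lborel {0..<2 * pi}. h (cis t))"
    unfolding arc_measure_def
    by (rule integral_distr)
      (use cis_measurable_circle borel_measurable_continuous_on_restrict[OF assms] in auto)
  also have "\<dots> = (LINT t|lborel. (indicator {0..<2 * pi} t / (2 * pi)) *\<^sub>R h (cis t))"
    unfolding um by (rule integral_density) auto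
  \<comment> \<open>The measure is defined from a half-open interval and contour integrals use the
    closed one; the extra point \<open>2 * pi\<close> is null.\<close>
  also have "\<dots> = (LINT t|lborel. (indicator {0..2 * pi} t *\<^sub>R h (cis t)) / (2 * pi))"
    by (rule integral_cong_AE)
      (use AE_lborel_singleton[of "2 * pi"] in \<open>auto elim!: eventually_mono simp: scaleR_conv_of_real split: split_indicator\<close>)
  also have "\<dots> = (LINT t|lborel. indicator {0..2 * pi} t *\<^sub>R h (cis t)) / (2 * pi)"
    by simp
  also have "(LINT t|lborel. indicator {0..2 * pi} t *\<^sub>R h (cis t)) = integral {0..2 * pi} (\<lambda>t. h (cis t))"
    using set_borel_integral_eq_integral(2)[OF borel_integrable_compact[OF compact_Icc hcis, unfolded set_integrable_def[symmetric], simplified set_integrable_def[symmetric]]]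
    by (simp add: set_lebesgue_integral_def)
  finally show ?thesis .
qed

text \<open>On the unit circle dz = i z dt. Dividing Cauchy's formula by 2 pi i therefore turns it
  into a mean over the circle, at the price of the extra factor \<zeta>.\<close>

lemma Cauchy_integral_arc_measure:
  assumes "continuous_on (cball 0 1) h" "h holomorphic_on disc" "z \<in> disc"
  shows "(LINT \<zeta>|arc_measure. h \<zeta> * \<zeta> / (\<zeta> - z)) = h z"
proof -
  have "((\<lambda>u. h u / (u - z)) has_contour_integral 2 * of_real pi * \<i> * h z) (circlepath 0 1)"
    using Cauchy_integral_circlepath[of 0 1 h z] assms by simp
  then have "((\<lambda>t. h (cis t) / (cis t - z) * \<i> * cis t) has_integral 2 * of_real pi * \<i> * h z) {0..2 * pi}"
    unfolding circlepath_def by (subst (asm) has_contour_integral_part_circlepath_iff) auto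
  then have "((\<lambda>t. (h (cis t) / (cis t - z) * \<i> * cis t) / \<i>) has_integral (2 * of_real pi * \<i> * h z) / \<i>) {0..2 * pi}"
    by (rule has_integral_divide)
  moreover have "a / b * \<i> * c / \<i> = a * c / b" and "2 * of_real pi * \<i> * a / \<i> = 2 * of_real pi * a"
    for a b c :: complex
    by (simp_all del: divide_i)
  ultimately have "integral {0..2 * pi} (\<lambda>t. h (cis t) * cis t / (cis t - z)) = 2 * of_real pi * h z"
    by (intro integral_unique) (simp only:)
  moreover have "continuous_on circle (\<lambda>\<zeta>. h \<zeta> * \<zeta> / (\<zeta> - z))"
    using assms by (intro continuous_intros continuous_on_subset[OF assms(1)]) auto
  ultimately show ?thesis
    by (subst integral_arc_measure) auto
qed

section \<open>The Poisson formula for holomorphic functions\<close>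

lemma poisson_kernel_nonneg: "z \<in> disc \<Longrightarrow> 0 \<le> poisson_kernel z \<zeta>"
  by (simp add: poisson_kernel_def power_le_one)

lemma continuous_on_poisson_kernel: "z \<in> disc \<Longrightarrow> continuous_on circle (poisson_kernel z)"
  unfolding poisson_kernel_def by (intro continuous_intros) auto

text \<open>Since cnj \<zeta> = 1/\<zeta> on the circle, the squared distance in the denominator is
  a rational function of \<zeta>. It splits into Cauchy's factor \<zeta> - z and a factor that has
  no zero in the closed disc.\<close>

lemma poisson_kernel_eq:
  assumes "\<zeta> \<in> circle" "z \<in> disc"
  shows "of_real (poisson_kernel z \<zeta>) = \<zeta> * (1 - z * cnj z) / ((\<zeta> - z) * (1 - cnj z * \<zeta>))"
proof -
  have \<zeta>: "\<zeta> * cnj \<zeta> = 1"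
    using assms by (simp add: complex_norm_square[symmetric])
  then have "\<zeta> \<noteq> 0" by auto
  have "1 - cnj z * \<zeta> = \<zeta> * cnj (\<zeta> - z)"
    using \<zeta> by (simp add: algebra_simps)
  then have "(\<zeta> - z) * (1 - cnj z * \<zeta>) = \<zeta> * of_real ((norm (\<zeta> - z))\<^sup>2)"
    by (simp only: complex_norm_square mult_ac)
  then show ?thesis
    using \<open>\<zeta> \<noteq> 0\<close> by (simp add: poisson_kernel_def flip: complex_norm_square)
qed

text \<open>On the circle, Cauchy's kernel applied to
  \<open>h(\<zeta>) (1 - \<bar>z\<bar>\<^sup>2) / (1 - cnj z \<zeta>)\<close> becomes the Poisson kernel applied to \<open>h\<close>.\<close>

lemma poisson_integral_continuous:
  assumes "continuous_on (cball 0 1) h" "h holomorphic_on disc" "z \<in> disc"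
  shows "(LINT \<zeta>|arc_measure. of_real (poisson_kernel z \<zeta>) * h \<zeta>) = h z"
proof -
  define k where "k = (\<lambda>u. h u * (1 - z * cnj z) / (1 - cnj z * u))"
  \<comment> \<open>The denominator of \<open>k\<close> could vanish only at 1 / cnj z, the mirror
    image of z in the circle, so \<open>k\<close> is as regular as \<open>h\<close>.\<close>
  have nz: "1 - cnj z * u \<noteq> 0" if "norm u \<le> 1" for u
  proof
    assume "1 - cnj z * u = 0"
    then have "norm (cnj z * u) = 1" by simp
    moreover have "norm (cnj z * u) \<le> norm z * 1"
      unfolding norm_mult using that by (intro mult_mono) auto
    ultimately show False using assms(3) by simp
  qed
  have "(LINT \<zeta>|arc_measure. of_real (poisson_kernel z \<zeta>) * h \<zeta>)
      = (LINT \<zeta>|arc_measure. k \<zeta> * \<zeta> / (\<zeta> - z))"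
    by (rule Bochner_Integration.integral_cong)
      (use assms(3) in \<open>simp_all add: poisson_kernel_eq k_def mult_ac\<close>)
  also have "\<dots> = k z"
    by (rule Cauchy_integral_arc_measure)
      (use assms nz in \<open>auto simp: k_def intro!: continuous_intros holomorphic_intros\<close>)
  also have "\<dots> = h z"
    using nz[of z] assms(3) by (simp add: k_def mult.commute)
  finally show ?thesis .
qed

lemma integral_poisson_kernel:
  assumes "z \<in> disc"
  shows "(LINT \<zeta>|arc_measure. poisson_kernel z \<zeta>) = 1"
proof -
  have "complex_of_real (LINT \<zeta>|arc_measure. poisson_kernel z \<zeta>) =
      (LINT \<zeta>|arc_measure. of_real (poisson_kernel z \<zeta>) * (\<lambda>_. 1) \<zeta>)"
    by simp
  also have "\<dots> = 1"
    using assms by (subst poisson_integral_continuous) auto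
  finally show ?thesis by (simp only: of_real_eq_1_iff)
qed

text \<open>Each dilate h(r u) with r < 1 is continuous up to the circle, so the formula holds for
  it. Dominated convergence with the bound \<open>poisson_kernel z \<zeta> * B\<close> then lets r
  tend to 1. A limit along one sequence of radii is enough.\<close>

lemma poisson_integral_bounded:
  fixes r :: "nat \<Rightarrow> real"
  assumes holo: "h holomorphic_on disc" and B: "\<And>u. u \<in> disc \<Longrightarrow> norm (h u) \<le> B"
    and z: "z \<in> disc" and hs: "hs \<in> borel_measurable arc_measure"
    and r: "r \<longlonglongrightarrow> 1" "\<And>n. 0 \<le> r n" "\<And>n. r n < 1"
    and lim: "AE \<zeta> in arc_measure. (\<lambda>n. h (of_real (r n) * \<zeta>)) \<longlonglongrightarrow> hs \<zeta>"
  shows "(LINT \<zeta>|arc_measure. of_real (poisson_kernel z \<zeta>) * hs \<zeta>) = h z"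
proof -
  have sub: "of_real (r n) * u \<in> disc" if "norm u \<le> 1" for n u
  proof -
    have "r n * norm u \<le> r n * 1"
      using that r(2) by (intro mult_left_mono) auto
    with r(3)[of n] r(2)[of n] show ?thesis by (simp add: norm_mult)
  qed
  have cont: "continuous_on (cball 0 1) (\<lambda>u. h (of_real (r n) * u))" for n
    by (rule continuous_on_compose2[OF holomorphic_on_imp_continuous_on[OF holo]])
      (use sub in \<open>auto intro!: continuous_intros\<close>)
  have hol: "(\<lambda>u. h (of_real (r n) * u)) holomorphic_on disc" for n
    using holomorphic_on_compose_gen[of "\<lambda>u. of_real (r n) * u" disc h disc] holo sub
    by (fastforce simp: o_def intro!: holomorphic_intros)
  have meas: "(\<lambda>u. h (of_real (r n) * u)) \<in> borel_measurable arc_measure" for n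
    by (rule continuous_on_imp_measurable_arc[OF continuous_on_subset[OF cont]]) auto
  have P: "poisson_kernel z \<in> borel_measurable arc_measure"
    by (intro continuous_on_imp_measurable_arc continuous_on_poisson_kernel z)
  have "(\<lambda>n. LINT \<zeta>|arc_measure. of_real (poisson_kernel z \<zeta>) * h (of_real (r n) * \<zeta>))
      \<longlonglongrightarrow> (LINT \<zeta>|arc_measure. of_real (poisson_kernel z \<zeta>) * hs \<zeta>)"
  proof (rule integral_dominated_convergence)
    show "integrable arc_measure (\<lambda>\<zeta>. poisson_kernel z \<zeta> * B)"
      by (intro continuous_on_imp_integrable_arc continuous_intros continuous_on_poisson_kernel z)
    show "AE \<zeta> in arc_measure. (\<lambda>n. of_real (poisson_kernel z \<zeta>) * h (of_real (r n) * \<zeta>)) \<longlonglongrightarrow>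
        of_real (poisson_kernel z \<zeta>) * hs \<zeta>"
      using lim by eventually_elim (intro tendsto_intros)
    show "AE \<zeta> in arc_measure. norm (of_real (poisson_kernel z \<zeta>) * h (of_real (r n) * \<zeta>)) \<le> poisson_kernel z \<zeta> * B" for n
    proof (rule AE_I2)
      fix \<zeta> assume "\<zeta> \<in> space arc_measure"
      then have "norm (h (of_real (r n) * \<zeta>)) \<le> B" by (intro B sub) auto
      then show "norm (of_real (poisson_kernel z \<zeta>) * h (of_real (r n) * \<zeta>)) \<le> poisson_kernel z \<zeta> * B"
        using poisson_kernel_nonneg[OF z] by (simp add: norm_mult mult_left_mono)
    qed
  qed (use meas P hs in measurable)
  moreover have "(\<lambda>n. LINT \<zeta>|arc_measure. of_real (poisson_kernel z \<zeta>) * h (of_real (r n) * \<zeta>)) = (\<lambda>n. h (of_real (r n) * z))"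
    by (intro ext poisson_integral_continuous cont hol z)
  moreover have "(\<lambda>n. h (of_real (r n) * z)) \<longlonglongrightarrow> h z"
  proof -
    have "isCont h z"
      using holo z by (auto simp: holomorphic_on_open field_differentiable_def intro: DERIV_isCont)
    moreover have "(\<lambda>n. of_real (r n) * z) \<longlonglongrightarrow> of_real 1 * z"
      by (intro tendsto_intros r)
    ultimately show ?thesis by (auto intro: isCont_tendsto_compose)
  qed
  ultimately show ?thesis by (metis LIMSEQ_unique)
qed

section \<open>Boundary values of inner functions\<close>

lemma filterlim_nontangential_iff:
  "filterlim f F (nontangential \<zeta>) \<longleftrightarrow> (\<forall>\<kappa>>1. filterlim f F (at \<zeta> within stolz_region \<kappa> \<zeta>))"
  unfolding filterlim_iff nontangential_def eventually_Sup by auto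

lemma nontangential_le_disc: "nontangential \<zeta> \<le> at \<zeta> within disc"
  unfolding nontangential_def by (intro SUP_least at_le) (auto simp: stolz_region_def)

text \<open>On a radius |r \<zeta> - \<zeta>| = 1 - r, so the radius lies in every Stolz region of
  aperture above 1; 2 is a convenient choice. Nontangential limits thus restrict to radial ones, and
  the filter is nontrivial, which makes its limits unique.\<close>

lemma filterlim_radial_nontangential:
  assumes "\<zeta> \<in> circle"
  shows "filterlim (\<lambda>r. of_real r * \<zeta>) (nontangential \<zeta>) (at_left 1)"
proof -
  have "((\<lambda>r. of_real r * \<zeta>) \<longlongrightarrow> of_real 1 * \<zeta>) (at_left 1)"
    by (intro tendsto_intros)
  moreover have "\<forall>\<^sub>F r in at_left 1. of_real r * \<zeta> \<in> stolz_region 2 \<zeta> - {\<zeta>}"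
  proof -
    have "\<forall>\<^sub>F r in at_left (1::real). r \<in> {0<..<1}"
      by (rule eventually_at_leftI[of 0]) auto
    then show ?thesis
    proof eventually_elim
      case (elim r)
      have "norm (of_real r * \<zeta> - \<zeta>) = norm (of_real (r - 1) * \<zeta>)"
        by (simp add: algebra_simps)
      also have "\<dots> = 1 - r"
        using elim assms unfolding norm_mult norm_of_real by simp
      finally show ?case
        using elim assms by (auto simp: stolz_region_def norm_mult)
    qed
  qed
  ultimately have "filterlim (\<lambda>r. of_real r * \<zeta>) (at \<zeta> within stolz_region 2 \<zeta>) (at_left 1)"
    unfolding filterlim_at by (auto elim: eventually_mono)
  moreover have "at \<zeta> within stolz_region 2 \<zeta> \<le> nontangential \<zeta>"
    unfolding nontangential_def by (rule SUP_upper) auto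
  ultimately show ?thesis
    by (rule filterlim_mono) auto
qed

lemma nontangential_neq_bot:
  assumes "\<zeta> \<in> circle"
  shows "nontangential \<zeta> \<noteq> bot"
proof
  assume "nontangential \<zeta> = bot"
  with filterlim_radial_nontangential[OF assms] show False
    by (simp add: filterlim_def bot.extremum_unique filtermap_bot_iff)
qed

lemma boundary_value_eqI:
  "\<zeta> \<in> circle \<Longrightarrow> (\<phi> \<longlongrightarrow> w) (nontangential \<zeta>) \<Longrightarrow> boundary_value \<phi> \<zeta> = w"
  unfolding boundary_value_def by (intro tendsto_Lim nontangential_neq_bot)

lemma filterlim_at_left_1_sequentially: "filterlim (\<lambda>n. 1 - 1 / (real n + 2)) (at_left 1) sequentially"
  unfolding filterlim_at by (auto intro!: always_eventually) real_asymp

lemma inner_function_norm_less: "inner_function \<phi> \<Longrightarrow> norm z < 1 \<Longrightarrow> norm (\<phi> z) < 1"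
  by (auto simp: inner_function_def image_subset_iff)

text \<open>Measurability of \<open>boundary_value\<close>, a limit along an uncountable family of
  approaches, is not evident. A limit of countably many continuous functions is Borel, and almost
  everywhere the limit along a sequence of radii is the nontangential one.\<close>

lemma inner_function_boundary_representative:
  assumes "inner_function \<phi>"
  obtains b where "b \<in> borel_measurable arc_measure" "\<And>\<zeta>. norm (b \<zeta>) = 1"
    "AE \<zeta> in arc_measure. (\<phi> \<longlongrightarrow> b \<zeta>) (nontangential \<zeta>)"
proof -
  define r where "r n = 1 - 1 / (real n + 2)" for n
  have r01: "\<bar>r n\<bar> < 1" for n
    by (simp add: r_def)
  define c where "c \<zeta> = lim (\<lambda>n. \<phi> (of_real (r n) * \<zeta>))" for \<zeta>
  \<comment> \<open>The default 1 on the bad null set makes \<open>b\<close> unimodular at every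
    point, so functions on the closed disc can be composed with \<open>b\<close> without
    exceptions.\<close>
  define b where "b \<zeta> = (if norm (c \<zeta>) = 1 then c \<zeta> else 1)" for \<zeta>
  have holo: "\<phi> holomorphic_on disc"
    using assms by (simp add: inner_function_def)
  have "continuous_on circle (\<lambda>\<zeta>. \<phi> (of_real (r n) * \<zeta>))" for n
    by (rule continuous_on_compose2[OF holomorphic_on_imp_continuous_on[OF holo]])
      (auto simp: norm_mult r01 intro!: continuous_intros)
  then have [measurable]: "c \<in> borel_measurable arc_measure"
    unfolding c_def by (intro borel_measurable_lim_metric continuous_on_imp_measurable_arc)
  have "AE \<zeta> in arc_measure. (\<phi> \<longlongrightarrow> b \<zeta>) (nontangential \<zeta>)"
  proof -
    have "AE \<zeta> in arc_measure. \<exists>w. (\<phi> \<longlongrightarrow> w) (nontangential \<zeta>) \<and> norm w = 1"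
      using assms unfolding inner_function_def circle_measure_eq AE_completion_iff by blast
    moreover have "AE \<zeta> in arc_measure. \<zeta> \<in> circle"
      using AE_space[of arc_measure] by simp
    ultimately show ?thesis
    proof eventually_elim
      case (elim \<zeta>)
      then obtain w where w: "(\<phi> \<longlongrightarrow> w) (nontangential \<zeta>)" "norm w = 1" by blast
      have "(\<lambda>n. \<phi> (of_real (r n) * \<zeta>)) \<longlonglongrightarrow> w"
        using filterlim_compose[OF filterlim_compose[OF w(1) filterlim_radial_nontangential]
            filterlim_at_left_1_sequentially] elim(2)
        by (simp add: r_def)
      then have "c \<zeta> = w"
        unfolding c_def by (rule limI)
      with w show ?case by (simp add: b_def)
    qed
  qed
  moreover have "b \<in> borel_measurable arc_measure"
    unfolding b_def by measurable
  moreover have "norm (b \<zeta>) = 1" for \<zeta>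
    by (simp add: b_def)
  ultimately show ?thesis by (rule that[rotated -1])
qed

text \<open>G o \<phi> is bounded and holomorphic, and by continuity of \<open>G\<close> its
  boundary values are G(b). Two choices of \<open>G\<close> are used later: powers, which show that
  level sets of the boundary values are null, and a Moebius map, which produces the Clark
  quotient.\<close>

lemma poisson_integral_inner_compose:
  assumes \<phi>: "inner_function \<phi>" and b: "b \<in> borel_measurable arc_measure" "\<And>\<zeta>. norm (b \<zeta>) = 1"
    and lim: "AE \<zeta> in arc_measure. (\<phi> \<longlongrightarrow> b \<zeta>) (nontangential \<zeta>)"
    and G: "continuous_on (cball 0 1) G" "G holomorphic_on disc" and z: "z \<in> disc"
  shows "(LINT \<zeta>|arc_measure. of_real (poisson_kernel z \<zeta>) * G (b \<zeta>)) = G (\<phi> z)"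
    and "integrable arc_measure (\<lambda>\<zeta>. of_real (poisson_kernel z \<zeta>) * G (b \<zeta>))"
proof -
  define r where "r n = 1 - 1 / (real n + 2)" for n
  have r01: "\<bar>r n\<bar> < 1" for n
    by (simp add: r_def)
  have holo: "\<phi> holomorphic_on disc" and into: "\<And>u. norm u < 1 \<Longrightarrow> norm (\<phi> u) < 1"
    using \<phi> inner_function_norm_less by (auto simp: inner_function_def)
  have "bounded (G ` cball 0 1)"
    by (intro compact_imp_bounded compact_continuous_image G) simp
  then obtain B where B: "\<And>x. x \<in> cball 0 1 \<Longrightarrow> norm (G x) \<le> B"
    unfolding bounded_iff by blast
  have Gb: "(\<lambda>\<zeta>. G (b \<zeta>)) \<in> borel_measurable arc_measure"
    by (rule measurable_compose[OF measurable_restrict_space2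
          borel_measurable_continuous_on_restrict[OF G(1)]])
      (use b in auto)
  have P: "poisson_kernel z \<in> borel_measurable arc_measure"
    by (intro continuous_on_imp_measurable_arc continuous_on_poisson_kernel z)
  show "integrable arc_measure (\<lambda>\<zeta>. of_real (poisson_kernel z \<zeta>) * G (b \<zeta>))"
  proof (rule Bochner_Integration.integrable_bound)
    show "integrable arc_measure (\<lambda>\<zeta>. poisson_kernel z \<zeta> * B)"
      by (intro continuous_on_imp_integrable_arc continuous_intros continuous_on_poisson_kernel z)
    show "(\<lambda>\<zeta>. of_real (poisson_kernel z \<zeta>) * G (b \<zeta>)) \<in> borel_measurable arc_measure"
      using P Gb by measurable
    show "AE \<zeta> in arc_measure. norm (of_real (poisson_kernel z \<zeta>) * G (b \<zeta>)) \<le> norm (poisson_kernel z \<zeta> * B)"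
      using B[of "b _"] b(2) poisson_kernel_nonneg[OF z] by (auto simp: norm_mult abs_mult intro!: AE_I2 mult_left_mono order_trans[OF _ abs_ge_self])
  qed
  have "(LINT \<zeta>|arc_measure. of_real (poisson_kernel z \<zeta>) * G (b \<zeta>)) = (G \<circ> \<phi>) z"
  proof (rule poisson_integral_bounded)
    show "G \<circ> \<phi> holomorphic_on disc"
      by (rule holomorphic_on_compose_gen[OF holo G(2)]) (use into in auto)
    show "norm ((G \<circ> \<phi>) u) \<le> B" if "u \<in> disc" for u
      using that into[of u] by (auto intro!: B)
    show "(\<lambda>\<zeta>. G (b \<zeta>)) \<in> borel_measurable arc_measure" by (rule Gb)
    show "r \<longlonglongrightarrow> 1" "\<And>n. 0 \<le> r n" "\<And>n. r n < 1"
      using filterlim_at_left_1_sequentially by (auto simp: r_def[abs_def] filterlim_at)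
    have "AE \<zeta> in arc_measure. \<zeta> \<in> circle"
      using AE_space[of arc_measure] by simp
    with lim show "AE \<zeta> in arc_measure. (\<lambda>n. (G \<circ> \<phi>) (of_real (r n) * \<zeta>)) \<longlonglongrightarrow> G (b \<zeta>)"
    proof eventually_elim
      case (elim \<zeta>)
      have "(\<lambda>n. \<phi> (of_real (r n) * \<zeta>)) \<longlonglongrightarrow> b \<zeta>"
        using filterlim_compose[OF filterlim_compose[OF elim(1) filterlim_radial_nontangential]
            filterlim_at_left_1_sequentially] elim(2)
        by (simp add: r_def)
      moreover have "\<phi> (of_real (r n) * \<zeta>) \<in> cball 0 1" for n
        using elim(2) by (auto intro!: less_imp_le into simp: norm_mult r01)
      ultimately show ?case
        using continuous_on_tendsto_compose[OF G(1), of "\<lambda>n. \<phi> (of_real (r n) * \<zeta>)" "b \<zeta>" sequentially] b(2)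
        by (simp add: o_def)
    qed
  qed (rule z)
  then show "(LINT \<zeta>|arc_measure. of_real (poisson_kernel z \<zeta>) * G (b \<zeta>)) = G (\<phi> z)" by simp
qed

text \<open>Strict convexity of the disc: the midpoint of 1 and another point of the closed disc is
  interior.\<close>

lemma norm_one_plus_half_less:
  fixes w :: complex
  assumes "norm w \<le> 1" "w \<noteq> 1"
  shows "norm ((1 + w) / 2) < 1"
proof -
  have "(norm (1 + w))\<^sup>2 = 1 + (norm w)\<^sup>2 + 2 * Re w"
    unfolding cmod_power2 by (simp add: power2_eq_square algebra_simps)
  moreover have "(norm w)\<^sup>2 \<le> 1"
    using assms(1) by (simp add: power_le_one)
  moreover have "Re w < 1"
  proof (rule ccontr)
    assume "\<not> Re w < 1"
    with complex_Re_le_cmod[of w] assms(1) have "Re w = 1" "norm w = 1" by auto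
    then have "w = 1"
      using cmod_power2[of w] by (simp add: complex_eq_iff)
    with assms(2) show False ..
  qed
  ultimately have "(norm (1 + w))\<^sup>2 < 2\<^sup>2" by simp
  then have "norm (1 + w) < 2" by (rule power2_less_imp_less) simp
  then show ?thesis by (simp add: norm_divide)
qed

text \<open>The functions \<open>((1 + cnj \<beta> \<phi>) / 2) ^ n\<close> tend to \<open>0\<close> at the origin, while their boundary
  values tend to the indicator of \<open>{\<phi>\<^sup>* = \<beta>}\<close>.\<close>

lemma inner_function_boundary_neq:
  assumes \<phi>: "inner_function \<phi>" and b: "b \<in> borel_measurable arc_measure" "\<And>\<zeta>. norm (b \<zeta>) = 1"
    and lim: "AE \<zeta> in arc_measure. (\<phi> \<longlongrightarrow> b \<zeta>) (nontangential \<zeta>)"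
    and \<beta>: "\<beta> \<in> circle"
  shows "AE \<zeta> in arc_measure. b \<zeta> \<noteq> \<beta>"
proof -
  define G where "G n w = ((1 + cnj \<beta> * w) / 2) ^ n" for n w
  define A where "A = {\<zeta> \<in> space arc_measure. b \<zeta> = \<beta>}"
  have A [measurable]: "A \<in> sets arc_measure"
    unfolding A_def using b(1) by measurable
  have \<beta>': "cnj \<beta> * w = 1 \<longleftrightarrow> w = \<beta>" if "norm w = 1" for w
  proof
    assume "cnj \<beta> * w = 1"
    then have "\<beta> * cnj \<beta> * w = \<beta>" by (simp add: mult.assoc)
    with \<beta> show "w = \<beta>" by (simp flip: complex_norm_square)
  next
    assume "w = \<beta>"
    with \<beta> show "cnj \<beta> * w = 1" by (simp add: mult.commute flip: complex_norm_square)
  qed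
  have "(LINT \<zeta>|arc_measure. G n (b \<zeta>)) = G n (\<phi> 0)" for n
  proof -
    have "(LINT \<zeta>|arc_measure. G n (b \<zeta>)) = (LINT \<zeta>|arc_measure. of_real (poisson_kernel 0 \<zeta>) * G n (b \<zeta>))"
      by (rule Bochner_Integration.integral_cong) (auto simp: poisson_kernel_def)
    also have "\<dots> = G n (\<phi> 0)"
      by (rule poisson_integral_inner_compose(1)[OF \<phi> b lim])
        (auto simp: G_def intro!: continuous_intros holomorphic_intros)
    finally show ?thesis .
  qed
  moreover have "(\<lambda>n. G n (\<phi> 0)) \<longlonglongrightarrow> 0"
  proof -
    have "norm (\<phi> 0) < 1"
      using \<phi> inner_function_norm_less by auto
    then have "norm (cnj \<beta> * \<phi> 0) < 1"
      using \<beta> by (simp add: norm_mult)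
    then have "norm ((1 + cnj \<beta> * \<phi> 0) / 2) < 1"
      by (intro norm_one_plus_half_less) auto
    then show ?thesis
      unfolding G_def by (rule LIMSEQ_power_zero)
  qed
  \<comment> \<open>Where \<open>b \<zeta>\<close> equals \<beta> the base of the power is 1;
    elsewhere it lies in the open disc. The constant 1 dominates all powers.\<close>
  moreover have "(\<lambda>n. LINT \<zeta>|arc_measure. G n (b \<zeta>)) \<longlonglongrightarrow> (LINT \<zeta>|arc_measure. indicator A \<zeta>)"
  proof (rule integral_dominated_convergence)
    show "integrable arc_measure (\<lambda>_. 1::real)" by simp
    show "(\<lambda>\<zeta>. G n (b \<zeta>)) \<in> borel_measurable arc_measure" for n
      unfolding G_def using b(1) by measurable
    show "AE \<zeta> in arc_measure. (\<lambda>n. G n (b \<zeta>)) \<longlonglongrightarrow> indicator A \<zeta>"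
    proof (rule AE_I2)
      fix \<zeta> assume \<zeta>: "\<zeta> \<in> space arc_measure"
      show "(\<lambda>n. G n (b \<zeta>)) \<longlonglongrightarrow> indicator A \<zeta>"
      proof (cases "b \<zeta> = \<beta>")
        case True
        then show ?thesis using \<zeta> \<beta>'[of \<beta>] \<beta> by (simp add: A_def G_def)
      next
        case False
        then have "norm ((1 + cnj \<beta> * b \<zeta>) / 2) < 1"
          using \<beta> b(2)[of \<zeta>] \<beta>'[of "b \<zeta>"] by (intro norm_one_plus_half_less) (auto simp: norm_mult)
        with False show ?thesis
          unfolding G_def by (simp add: A_def LIMSEQ_power_zero)
      qed
    qed
    show "AE \<zeta> in arc_measure. norm (G n (b \<zeta>)) \<le> 1" for n
    proof (rule AE_I2)
      fix \<zeta>
      have "norm (1 + cnj \<beta> * b \<zeta>) \<le> 2"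
        using \<beta> b(2) norm_triangle_ineq[of 1 "cnj \<beta> * b \<zeta>"] by (simp add: norm_mult)
      then show "norm (G n (b \<zeta>)) \<le> 1"
        by (simp add: G_def norm_power norm_divide power_le_one)
    qed
  qed measurable
  ultimately have "(LINT \<zeta>|arc_measure. indicator A \<zeta> :: complex) = 0"
    using LIMSEQ_unique by force
  moreover have "(LINT \<zeta>|arc_measure. indicator A \<zeta> :: complex) = of_real (measure arc_measure A)"
  proof -
    have "(LINT \<zeta>|arc_measure. indicator A \<zeta> :: complex) = (LINT \<zeta>|arc_measure. of_real (indicator A \<zeta>))"
      by (intro Bochner_Integration.integral_cong) (auto simp: indicator_def)
    also have "\<dots> = of_real (measure arc_measure A)"
      unfolding integral_complex_of_real using sets.Int_space_eq2[OF A] by simp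
    finally show ?thesis .
  qed
  ultimately have "emeasure arc_measure A = 0"
    by (simp add: arc.emeasure_eq_measure)
  then show ?thesis
    using A by (intro AE_I[of _ _ A]) (auto simp: A_def)
qed

section \<open>Atoms of Clark measures\<close>

lemma clark_measure_sets:
  assumes "is_clark_measure \<psi> \<beta> \<tau>"
  shows "space \<tau> = circle" "sets \<tau> = sets (restrict_space borel circle)"
  using assms by (auto simp: is_clark_measure_def)

lemma clark_measure_eq:
  "is_clark_measure \<psi> \<beta> \<tau> \<Longrightarrow> z \<in> disc \<Longrightarrow>
    (LINT \<zeta>|\<tau>. poisson_kernel z \<zeta>) = (1 - (norm (\<psi> z))\<^sup>2) / (norm (\<beta> - \<psi> z))\<^sup>2"
  by (simp add: is_clark_measure_def)

text \<open>A non-integrable function has integral 0, so a nonzero integral of the constant 1 forces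
  finite total mass. The definition of a Clark measure states only its Poisson integrals; taking z =
  0, where the kernel is 1, yields finiteness this way.\<close>

lemma integral_nonzero_imp_finite_measure:
  assumes "(LINT x|M. (1::real)) \<noteq> 0"
  shows "finite_measure M"
proof
  have "integrable M (\<lambda>x. 1::real)"
    using assms not_integrable_integral_eq by blast
  then have "integrable M (indicator (space M) :: _ \<Rightarrow> real)"
    by (rule Bochner_Integration.integrable_cong[THEN iffD1, rotated 2]) auto
  then have "emeasure M (space M) < \<infinity>"
    by (subst (asm) integrable_indicator_iff) simp
  then show "emeasure M (space M) \<noteq> \<infinity>" by simp
qed

lemma clark_quotient_pos:
  fixes w \<beta> :: complex
  assumes "norm w < 1" "norm \<beta> = 1"
  shows "0 < (1 - (norm w)\<^sup>2) / (norm (\<beta> - w))\<^sup>2"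
proof -
  have "(norm w)\<^sup>2 < 1" "w \<noteq> \<beta>"
    using assms by (auto simp: abs_square_less_1)
  then show ?thesis by auto
qed

lemma clark_measure_finite:
  assumes "is_clark_measure \<psi> \<beta> \<tau>" "norm (\<psi> 0) < 1" "\<beta> \<in> circle"
  shows "finite_measure \<tau>"
proof (rule integral_nonzero_imp_finite_measure)
  have "(LINT \<zeta>|\<tau>. (1::real)) = (LINT \<zeta>|\<tau>. poisson_kernel 0 \<zeta>)"
    by (rule Bochner_Integration.integral_cong)
      (auto simp: poisson_kernel_def clark_measure_sets[OF assms(1)])
  also have "\<dots> > 0"
    using clark_measure_eq[OF assms(1)] clark_quotient_pos[OF assms(2)] assms(3) by simp
  finally show "(LINT \<zeta>|\<tau>. (1::real)) \<noteq> 0" by simp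
qed

lemma poisson_kernel_integrable:
  assumes "sets M = sets (restrict_space borel circle)" "finite_measure M" "z \<in> disc"
  shows "integrable M (poisson_kernel z)"
  using compact_borel_measureI[OF assms(2,1)] continuous_on_poisson_kernel[OF assms(3)]
  by (simp add: compact_borel_measure.continuous_on_imp_integrable)

text \<open>By positivity, one atom contributes at most the whole Poisson integral.\<close>

lemma clark_atom_le:
  assumes \<tau>: "is_clark_measure \<psi> \<beta> \<tau>" "finite_measure \<tau>" and "z \<in> disc" "\<eta> \<in> circle"
  shows "measure \<tau> {\<eta>} * poisson_kernel z \<eta> \<le> (1 - (norm (\<psi> z))\<^sup>2) / (norm (\<beta> - \<psi> z))\<^sup>2"
proof -
  interpret finite_measure \<tau> by fact
  note ts = clark_measure_sets[OF \<tau>(1)]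
  have "{\<eta>} \<in> sets \<tau>"
    using assms(4) by (auto simp: ts sets_restrict_space intro!: image_eqI[of _ _ "{\<eta>}"])
  then have "measure \<tau> {\<eta>} * poisson_kernel z \<eta> = (LINT \<zeta>|\<tau>. indicator {\<eta>} \<zeta> * poisson_kernel z \<eta>)"
    using sets.Int_space_eq2[of "{\<eta>}" \<tau>] by simp
  also have "\<dots> \<le> (LINT \<zeta>|\<tau>. poisson_kernel z \<zeta>)"
  proof (rule integral_mono)
    have "integrable \<tau> (indicat_real {\<eta>})"
      using \<open>{\<eta>} \<in> sets \<tau>\<close> by (intro integrable_real_indicator) (auto simp: less_top[symmetric])
    then show "integrable \<tau> (\<lambda>\<zeta>. indicator {\<eta>} \<zeta> * poisson_kernel z \<eta>)"
      by (rule integrable_mult_left)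
  qed (use poisson_kernel_nonneg[OF assms(3)] in
      \<open>auto split: split_indicator intro!: poisson_kernel_integrable ts \<tau> assms(3)\<close>)
  finally show ?thesis
    using clark_measure_eq[OF \<tau>(1) assms(3)] by simp
qed

text \<open>Let c be the mass of the atom and d = |\<beta> - \<psi>(z)|. In a Stolz region the
  kernel at \<eta> is at least 1 / (\<kappa>^2 (1 - |z|)), while the Clark quotient is at most 2/d
  because 1 - |\<psi>(z)| \<le> d. Comparing the two gives d \<le> 2 \<kappa>^2 (1 - |z|) / c, which
  tends to 0.\<close>

lemma clark_atom_imp_boundary_solution:
  assumes \<tau>: "is_clark_measure \<psi> \<beta> \<tau>" "finite_measure \<tau>"
    and \<psi>: "\<And>z. norm z < 1 \<Longrightarrow> norm (\<psi> z) < 1"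
    and \<beta>: "\<beta> \<in> circle" and \<eta>: "\<eta> \<in> circle" and pos: "measure \<tau> {\<eta>} > 0"
  shows "\<eta> \<in> boundary_solutions \<psi> \<beta>"
proof -
  define c where "c = measure \<tau> {\<eta>}"
  have bound: "norm (\<psi> z - \<beta>) \<le> 2 * \<kappa>\<^sup>2 / c * (1 - norm z)" if z: "z \<in> stolz_region \<kappa> \<eta>" and "\<kappa> > 1" for z \<kappa>
  proof -
    from z have z1: "norm z < 1" and zk: "norm (z - \<eta>) < \<kappa> * (1 - norm z)"
      by (auto simp: stolz_region_def)
    define d where "d = norm (\<beta> - \<psi> z)"
    define s where "s = norm (\<eta> - z)"
    have s: "0 < s" "s < \<kappa> * (1 - norm z)"
      using z1 zk \<eta> by (auto simp: s_def norm_minus_commute)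
    have d: "1 - norm (\<psi> z) \<le> d" "0 < d"
      using norm_triangle_ineq2[of \<beta> "\<psi> z"] \<beta> \<psi>[OF z1] by (auto simp: d_def)
    have "c * (1 - norm z) / (\<kappa> * (1 - norm z))\<^sup>2 \<le> c * (1 - (norm z)\<^sup>2) / s\<^sup>2"
    proof (rule frac_le)
      have "(norm z)\<^sup>2 \<le> norm z"
        using z1 by (simp add: power2_eq_square mult_left_le)
      then show "c * (1 - norm z) \<le> c * (1 - (norm z)\<^sup>2)"
        using pos by (intro mult_left_mono) (auto simp: c_def)
      show "0 \<le> c * (1 - (norm z)\<^sup>2)"
        using pos z1 by (auto simp: c_def power_le_one)
      show "0 < s\<^sup>2" "s\<^sup>2 \<le> (\<kappa> * (1 - norm z))\<^sup>2"
        using s by (auto intro!: power_mono)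
    qed
    also have "\<dots> \<le> (1 - (norm (\<psi> z))\<^sup>2) / d\<^sup>2"
      using clark_atom_le[OF \<tau> _ \<eta>, of z] z1 by (simp add: c_def d_def s_def poisson_kernel_def)
    also have "\<dots> \<le> 2 * d / d\<^sup>2"
    proof (rule divide_right_mono)
      have "1 - (norm (\<psi> z))\<^sup>2 = (1 - norm (\<psi> z)) * (1 + norm (\<psi> z))"
        by (simp add: power2_eq_square algebra_simps)
      also have "\<dots> \<le> d * 2"
        using d \<psi>[OF z1] by (intro mult_mono) auto
      finally show "1 - (norm (\<psi> z))\<^sup>2 \<le> 2 * d" by simp
    qed auto
    also have "\<dots> = 2 / d" using d by (simp add: power2_eq_square)
    finally have "c / (\<kappa>\<^sup>2 * (1 - norm z)) \<le> 2 / d"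
      using z1 by (simp add: power2_eq_square)
    then have "c * d \<le> 2 * \<kappa>\<^sup>2 * (1 - norm z)"
      using z1 d \<open>\<kappa> > 1\<close> by (simp add: field_simps)
    then show ?thesis
      using pos by (simp add: d_def norm_minus_commute c_def field_simps)
  qed
  have "((\<lambda>z. \<psi> z - \<beta>) \<longlongrightarrow> 0) (at \<eta> within stolz_region \<kappa> \<eta>)" if "\<kappa> > 1" for \<kappa>
  proof (rule Lim_null_comparison)
    show "\<forall>\<^sub>F z in at \<eta> within stolz_region \<kappa> \<eta>. norm (\<psi> z - \<beta>) \<le> 2 * \<kappa>\<^sup>2 / c * (1 - norm z)"
      using bound that by (auto simp: eventually_at_filter)
    have "((\<lambda>z. 2 * \<kappa>\<^sup>2 / c * (1 - norm z)) \<longlongrightarrow> 2 * \<kappa>\<^sup>2 / c * (1 - norm \<eta>)) (at \<eta> within stolz_region \<kappa> \<eta>)"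
      by (intro tendsto_intros)
    with \<eta> show "((\<lambda>z. 2 * \<kappa>\<^sup>2 / c * (1 - norm z)) \<longlongrightarrow> 0) (at \<eta> within stolz_region \<kappa> \<eta>)"
      by simp
  qed
  then have "(\<psi> \<longlongrightarrow> \<beta>) (nontangential \<eta>)"
    unfolding filterlim_nontangential_iff by (auto simp: LIM_zero_iff)
  with \<eta> show ?thesis by (simp add: boundary_solutions_def)
qed

text \<open>The weight 1 - r tames the kernel at r \<eta>: the product is 1 + r at \<eta>, tends to
  0 at all other points and never exceeds 2. Dominated convergence then leaves only the atom at
  \<eta>.\<close>

lemma clark_atom_radial_limit:
  assumes \<tau>: "is_clark_measure \<psi> \<beta> \<tau>" "finite_measure \<tau>" and \<eta>: "\<eta> \<in> circle"
    and r: "r \<longlonglongrightarrow> 1" "\<And>n. 0 \<le> r n" "\<And>n. r n < 1"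
  shows "(\<lambda>n. (1 - r n) * ((1 - (norm (\<psi> (of_real (r n) * \<eta>)))\<^sup>2) / (norm (\<beta> - \<psi> (of_real (r n) * \<eta>)))\<^sup>2))
    \<longlonglongrightarrow> 2 * measure \<tau> {\<eta>}"
proof -
  interpret finite_measure \<tau> by fact
  note ts = clark_measure_sets[OF \<tau>(1)]
  have \<eta>s: "{\<eta>} \<in> sets \<tau>"
    using \<eta> by (auto simp: ts sets_restrict_space intro!: image_eqI[of _ _ "{\<eta>}"])
  have in_disc: "of_real (r n) * \<eta> \<in> disc" for n
    using r \<eta> by (simp add: norm_mult)
  have norm_r: "norm (of_real (r n) * \<eta>) = r n" for n
    using r \<eta> by (simp add: norm_mult)
  \<comment> \<open>No point of the circle is closer to r \<eta> than \<eta> itself, so the kernel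
    is largest there; this is the source of the dominating constant.\<close>
  have far: "1 - r n \<le> norm (\<zeta> - of_real (r n) * \<eta>)" if "\<zeta> \<in> circle" for n \<zeta>
    using norm_triangle_ineq2[of \<zeta> "of_real (r n) * \<eta>"] that norm_r[of n] by simp
  have near: "norm (\<eta> - of_real (r n) * \<eta>) = 1 - r n" for n
  proof -
    have "norm (\<eta> - of_real (r n) * \<eta>) = norm (of_real (1 - r n) * \<eta>)"
      by (simp add: algebra_simps)
    then show ?thesis
      using r(3)[of n] \<eta> unfolding norm_mult norm_of_real by simp
  qed
  have cancel: "(1 - x) * ((1 - x\<^sup>2) / (1 - x)\<^sup>2) = 1 + x" if "x < 1" for x :: real
  proof -
    have "1 - x\<^sup>2 = (1 - x) * (1 + x)"
      by (simp add: power2_eq_square algebra_simps)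
    then show ?thesis using that by (simp add: power2_eq_square)
  qed
  have "(\<lambda>n. LINT \<zeta>|\<tau>. (1 - r n) * poisson_kernel (of_real (r n) * \<eta>) \<zeta>)
      \<longlonglongrightarrow> (LINT \<zeta>|\<tau>. 2 * indicator {\<eta>} \<zeta>)"
  proof (rule integral_dominated_convergence)
    show "integrable \<tau> (\<lambda>_. 2::real)" by simp
    show "(\<lambda>\<zeta>. 2 * indicator {\<eta>} \<zeta> :: real) \<in> borel_measurable \<tau>"
      using \<eta>s by measurable
    show "(\<lambda>\<zeta>. (1 - r n) * poisson_kernel (of_real (r n) * \<eta>) \<zeta>) \<in> borel_measurable \<tau>" for n
      using poisson_kernel_integrable[OF ts(2) \<tau>(2) in_disc]
      by (intro borel_measurable_times borel_measurable_const borel_measurable_integrable)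
    show "AE \<zeta> in \<tau>. (\<lambda>n. (1 - r n) * poisson_kernel (of_real (r n) * \<eta>) \<zeta>) \<longlonglongrightarrow> 2 * indicator {\<eta>} \<zeta>"
    proof (rule AE_I2)
      fix \<zeta> assume "\<zeta> \<in> space \<tau>"
      show "(\<lambda>n. (1 - r n) * poisson_kernel (of_real (r n) * \<eta>) \<zeta>) \<longlonglongrightarrow> 2 * indicator {\<eta>} \<zeta>"
      proof (cases "\<zeta> = \<eta>")
        case True
        have "(\<lambda>n. 1 + r n) \<longlonglongrightarrow> 1 + 1" by (intro tendsto_intros r)
        then show ?thesis
          using True r(3) by (simp add: poisson_kernel_def near norm_r cancel del: times_divide_eq_right)
      next
        case False
        have "(\<lambda>n. (1 - r n) * ((1 - (r n)\<^sup>2) / (norm (\<zeta> - of_real (r n) * \<eta>))\<^sup>2))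
            \<longlonglongrightarrow> (1 - 1) * ((1 - 1\<^sup>2) / (norm (\<zeta> - of_real 1 * \<eta>))\<^sup>2)"
          by (intro tendsto_intros r) (use False in auto)
        then show ?thesis
          using False by (simp add: poisson_kernel_def norm_r)
      qed
    qed
    show "AE \<zeta> in \<tau>. norm ((1 - r n) * poisson_kernel (of_real (r n) * \<eta>) \<zeta>) \<le> 2" for n
    proof (rule AE_I2)
      fix \<zeta> assume \<zeta>: "\<zeta> \<in> space \<tau>"
      have "0 \<le> poisson_kernel (of_real (r n) * \<eta>) \<zeta>"
        by (rule poisson_kernel_nonneg[OF in_disc])
      then have "norm ((1 - r n) * poisson_kernel (of_real (r n) * \<eta>) \<zeta>)
          = (1 - r n) * poisson_kernel (of_real (r n) * \<eta>) \<zeta>"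
        using r(3)[of n] by (simp add: abs_mult)
      also have "\<dots> = (1 - r n) * ((1 - (r n)\<^sup>2) / (norm (\<zeta> - of_real (r n) * \<eta>))\<^sup>2)"
        by (simp add: poisson_kernel_def norm_r)
      also have "\<dots> \<le> (1 - r n) * ((1 - (r n)\<^sup>2) / (1 - r n)\<^sup>2)"
        using far[of \<zeta> n] r(2)[of n] r(3)[of n] \<zeta> ts(1)
        by (intro mult_left_mono frac_le power_mono) (auto simp: power_le_one)
      also have "\<dots> \<le> 2"
        using cancel r(3)[of n] by simp
      finally show "norm ((1 - r n) * poisson_kernel (of_real (r n) * \<eta>) \<zeta>) \<le> 2" .
    qed
  qed
  moreover have "(LINT \<zeta>|\<tau>. 2 * indicator {\<eta>} \<zeta>) = 2 * measure \<tau> {\<eta>}"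
    using sets.Int_space_eq2[OF \<eta>s] by simp
  ultimately show ?thesis
    using clark_measure_eq[OF \<tau>(1) in_disc] by simp
qed

text \<open>The weights in \<open>discrete_measure\<close> are forced to be the point masses, and
  points outside its countable set have mass 0. Summing over the whole space removes that set from
  the formula, so that the boundary solutions can take its place later.\<close>

lemma nn_integral_discrete_measure:
  assumes D: "discrete_measure \<tau>" and sing: "\<And>x. x \<in> space \<tau> \<Longrightarrow> {x} \<in> sets \<tau>"
    and h: "h \<in> borel_measurable \<tau>"
  shows "(\<integral>\<^sup>+x. h x \<partial>\<tau>) = (\<integral>\<^sup>+x. emeasure \<tau> {x} * h x \<partial>count_space (space \<tau>))"
proof -
  obtain S c where S: "S \<subseteq> space \<tau>"
    and em: "\<And>A. A \<in> sets \<tau> \<Longrightarrow> emeasure \<tau> A = (\<integral>\<^sup>+ s. c s * indicator A s \<partial>count_space S)"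
    using D unfolding discrete_measure_def by blast
  have id: "(\<lambda>x. x) \<in> count_space S \<rightarrow>\<^sub>M \<tau>"
    using S by auto
  \<comment> \<open>The weighted counting measure lives on the power set of \<open>S\<close>;
    pushing it forward along the inclusion brings it to the sigma-algebra of \<tau>.\<close>
  have "\<tau> = distr (density (count_space S) c) \<tau> (\<lambda>x. x)"
  proof (rule measure_eqI)
    fix A assume A: "A \<in> sets \<tau>"
    have "emeasure (distr (density (count_space S) c) \<tau> (\<lambda>x. x)) A = emeasure (density (count_space S) c) (A \<inter> S)"
      using A id by (subst emeasure_distr) auto
    also have "\<dots> = (\<integral>\<^sup>+ s. c s * indicator (A \<inter> S) s \<partial>count_space S)"
      by (subst emeasure_density) auto
    also have "\<dots> = emeasure \<tau> A"
      unfolding em[OF A] by (rule nn_integral_cong) (auto split: split_indicator)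
    finally show "emeasure \<tau> A = emeasure (distr (density (count_space S) c) \<tau> (\<lambda>x. x)) A" by simp
  qed simp
  then have "(\<integral>\<^sup>+x. h x \<partial>\<tau>) = (\<integral>\<^sup>+x. h x \<partial>distr (density (count_space S) c) \<tau> (\<lambda>x. x))"
    by simp
  also have "\<dots> = (\<integral>\<^sup>+x. c x * h x \<partial>count_space S)"
    using h id by (subst nn_integral_distr) (auto simp: nn_integral_density)
  also have "\<dots> = (\<integral>\<^sup>+x. emeasure \<tau> {x} * h x \<partial>count_space S)"
  proof (rule nn_integral_cong)
    fix x assume x: "x \<in> space (count_space S)"
    then have "emeasure \<tau> {x} = (\<integral>\<^sup>+ s. c x * indicator {x} s \<partial>count_space S)"
      using S sing by (subst em) (auto intro!: nn_integral_cong split: split_indicator)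
    also have "\<dots> = c x"
      using x by (subst nn_integral_cmult_indicator) auto
    finally show "c x * h x = emeasure \<tau> {x} * h x" by simp
  qed
  also have "\<dots> = (\<integral>\<^sup>+x. emeasure \<tau> {x} * h x \<partial>count_space (space \<tau>))"
  proof (rule nn_integral_count_space_eq)
    fix x assume x: "x \<in> space \<tau> - S"
    then have "(\<integral>\<^sup>+ s. c s * indicator {x} s \<partial>count_space S) = (\<integral>\<^sup>+ s. 0 \<partial>count_space S)"
      by (intro nn_integral_cong) (auto split: split_indicator)
    then have "emeasure \<tau> {x} = 0"
      using em[of "{x}"] sing x by simp
    then show "emeasure \<tau> {x} * h x = 0" by simp
  qed (use S in auto)
  finally show ?thesis .
qed

text \<open>The derivative is taken within the closed disc, so \<eta> may be approached along any
  segment pointing strictly inwards; such directions are -\<eta> v with Re v > 0.\<close>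

lemma boundary_difference_quotient:
  fixes F :: "complex \<Rightarrow> complex"
  assumes der: "(F has_field_derivative D) (at \<eta> within cball 0 1 - E)"
    and E: "E \<subseteq> circle" and \<eta>: "\<eta> \<in> circle" and v: "Re v > 0"
  shows "((\<lambda>t. (F (\<eta> * (1 - of_real t * v)) - F \<eta>) / of_real t) \<longlongrightarrow> - (D * \<eta> * v)) (at_right 0)"
    and "\<forall>\<^sub>F t in at_right 0. \<eta> * (1 - of_real t * v) \<in> disc"
proof -
  have "v \<noteq> 0" "\<eta> \<noteq> 0" using v \<eta> by auto
  show in_disc: "\<forall>\<^sub>F t in at_right 0. \<eta> * (1 - of_real t * v) \<in> disc"
  proof -
    \<comment> \<open>This is where the ray 1 - t v leaves the disc again: |1 - t v|^2 = 1 - t (2 Re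
      v - t |v|^2).\<close>
    have pos: "0 < 2 * Re v / (norm v)\<^sup>2"
      using v \<open>v \<noteq> 0\<close> by simp
    show ?thesis
      using eventually_at_right_real[OF pos]
    proof eventually_elim
      case (elim t)
      have "(norm (1 - of_real t * v))\<^sup>2 = 1 - t * (2 * Re v - t * (norm v)\<^sup>2)"
        unfolding cmod_power2 by (simp add: power2_eq_square algebra_simps)
      also have "\<dots> < 1"
        using elim \<open>v \<noteq> 0\<close> by (simp add: field_simps)
      finally have "norm (1 - of_real t * v) < 1"
        by (simp add: abs_square_less_1)
      then show ?case using \<eta> by (simp add: norm_mult)
    qed
  qed
  define \<gamma> where "\<gamma> t = \<eta> * (1 - of_real t * v)" for t :: real
  have pos_t: "\<forall>\<^sub>F t in at_right (0::real). t \<noteq> 0"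
    by (auto simp: eventually_at_filter)
  have "(\<gamma> \<longlongrightarrow> \<eta> * (1 - of_real 0 * v)) (at_right 0)"
    unfolding \<gamma>_def by (intro tendsto_intros)
  moreover have "\<forall>\<^sub>F t in at_right 0. \<gamma> t \<in> (cball 0 1 - E) - {\<eta>}"
    using in_disc pos_t by eventually_elim (use E \<eta> in \<open>auto simp: \<gamma>_def\<close>)
  ultimately have "filterlim \<gamma> (at \<eta> within cball 0 1 - E) (at_right 0)"
    unfolding filterlim_at by (auto elim: eventually_mono)
  with der have "((\<lambda>t. (F (\<gamma> t) - F \<eta>) / (\<gamma> t - \<eta>)) \<longlongrightarrow> D) (at_right 0)"
    unfolding has_field_derivative_iff by (rule filterlim_compose)
  then have "((\<lambda>t. (F (\<gamma> t) - F \<eta>) / (\<gamma> t - \<eta>) * (- (\<eta> * v))) \<longlongrightarrow> D * (- (\<eta> * v))) (at_right 0)"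
    by (intro tendsto_intros)
  moreover have "\<forall>\<^sub>F t in at_right 0. (F (\<gamma> t) - F \<eta>) / (\<gamma> t - \<eta>) * (- (\<eta> * v)) =
      (F (\<eta> * (1 - of_real t * v)) - F \<eta>) / of_real t"
    using pos_t
  proof eventually_elim
    case (elim t)
    have "\<gamma> t - \<eta> = - (\<eta> * v) * of_real t"
      by (simp add: \<gamma>_def algebra_simps)
    then show ?case
      using elim \<open>v \<noteq> 0\<close> \<open>\<eta> \<noteq> 0\<close> by (simp add: \<gamma>_def)
  qed
  ultimately show "((\<lambda>t. (F (\<eta> * (1 - of_real t * v)) - F \<eta>) / of_real t) \<longlongrightarrow> - (D * \<eta> * v)) (at_right 0)"
    using tendsto_cong by (force simp: mult.assoc)
qed

text \<open>Since \<open>F\<close> maps the disc into itself, its derivative at a boundary point with unimodular value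
  maps the inward half-plane at \<open>\<eta>\<close> into the inward half-plane at \<open>\<beta>\<close>.\<close>

lemma boundary_derivative_real:
  fixes F :: "complex \<Rightarrow> complex"
  assumes der: "(F has_field_derivative D) (at \<eta> within cball 0 1 - E)"
    and E: "E \<subseteq> circle" and \<eta>: "\<eta> \<in> circle"
    and F: "\<And>z. z \<in> disc \<Longrightarrow> norm (F z) < 1" "F \<eta> = \<beta>" and \<beta>: "\<beta> \<in> circle"
  shows "cnj \<beta> * D * \<eta> = of_real (norm D)"
proof -
  define w where "w = cnj \<beta> * D * \<eta>"
  \<comment> \<open>Re (cnj \<beta> F) is at most 1 in the disc and equals 1 at \<eta>, so its
    difference quotients along inward segments are nonpositive.\<close>
  have half: "0 \<le> Re (w * v)" if v: "Re v > 0" for v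
  proof -
    note q = boundary_difference_quotient[OF der E \<eta> v]
    have "((\<lambda>t. Re (cnj \<beta> * ((F (\<eta> * (1 - of_real t * v)) - F \<eta>) / of_real t))) \<longlongrightarrow> Re (cnj \<beta> * - (D * \<eta> * v))) (at_right 0)"
      by (intro tendsto_intros q(1))
    moreover have "\<forall>\<^sub>F t in at_right 0. Re (cnj \<beta> * ((F (\<eta> * (1 - of_real t * v)) - F \<eta>) / of_real t)) \<le> 0"
      using q(2) eventually_at_right_less[of 0]
    proof eventually_elim
      case (elim t)
      let ?u = "F (\<eta> * (1 - of_real t * v))"
      have "Re (cnj \<beta> * ?u) \<le> norm (cnj \<beta> * ?u)" by (rule complex_Re_le_cmod)
      also have "\<dots> \<le> 1" using F(1)[OF elim(1)] \<beta> by (simp add: norm_mult)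
      also have "1 = Re (cnj \<beta> * \<beta>)"
        using \<beta> by (simp add: mult.commute flip: complex_norm_square)
      finally have "Re (cnj \<beta> * (?u - F \<eta>)) \<le> 0"
        unfolding F(2) by (simp add: algebra_simps)
      then have "Re (cnj \<beta> * (?u - F \<eta>)) / t \<le> 0"
        using elim(2) by (simp add: divide_nonpos_pos)
      then show ?case by (simp only: Re_divide_of_real times_divide_eq_right)
    qed
    ultimately have "Re (cnj \<beta> * - (D * \<eta> * v)) \<le> 0"
      by (rule tendsto_upperbound) simp
    then show ?thesis by (simp add: w_def mult.assoc)
  qed
  have Im0: "Im w = 0"
  proof (rule ccontr)
    assume "Im w \<noteq> 0"
    \<comment> \<open>If w were not real, the right half-plane would contain a v that w turns to the
      left; the imaginary part of v is solved from Re (w v) = -1.\<close>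
    then have "Re (w * Complex 1 ((Re w + 1) / Im w)) = -1" by (simp add: field_simps)
    with half[of "Complex 1 ((Re w + 1) / Im w)"] show False by simp
  qed
  moreover have "0 \<le> Re w"
    using half[of 1] by simp
  moreover have "norm w = norm D"
    using \<beta> \<eta> by (simp add: w_def norm_mult)
  ultimately show ?thesis
    unfolding w_def[symmetric] by (simp add: complex_eq_iff cmod_def)
qed

text \<open>Harnack's inequality: the kernel is at least (1 - |z|) / (1 + |z|), hence at least (1 -
  |z|) / 2 uniformly in \<zeta>, and integration preserves this.\<close>

lemma clark_measure_harnack:
  assumes \<tau>: "is_clark_measure \<psi> \<beta> \<tau>" "finite_measure \<tau>" and z: "z \<in> disc"
  shows "(1 - (norm (\<psi> 0))\<^sup>2) / (norm (\<beta> - \<psi> 0))\<^sup>2 * ((1 - norm z) / 2) \<le>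
    (1 - (norm (\<psi> z))\<^sup>2) / (norm (\<beta> - \<psi> z))\<^sup>2"
proof -
  have "(LINT \<zeta>|\<tau>. poisson_kernel 0 \<zeta> * ((1 - norm z) / 2)) \<le> (LINT \<zeta>|\<tau>. poisson_kernel z \<zeta>)"
  proof (rule integral_mono)
    show "integrable \<tau> (\<lambda>\<zeta>. poisson_kernel 0 \<zeta> * ((1 - norm z) / 2))"
      by (intro integrable_mult_left poisson_kernel_integrable clark_measure_sets[OF \<tau>(1)] \<tau>) simp
    show "integrable \<tau> (poisson_kernel z)"
      by (intro poisson_kernel_integrable clark_measure_sets[OF \<tau>(1)] \<tau> z)
    fix \<zeta> assume "\<zeta> \<in> space \<tau>"
    then have \<zeta>: "norm \<zeta> = 1" by (simp add: clark_measure_sets[OF \<tau>(1)])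
    have "(1 - norm z) / 2 \<le> (1 - norm z) / (1 + norm z)"
      using z by (intro frac_le) (auto intro: add_pos_nonneg)
    also have "\<dots> = (1 - (norm z)\<^sup>2) / (1 + norm z)\<^sup>2"
    proof -
      have "1 - (norm z)\<^sup>2 = (1 - norm z) * (1 + norm z)"
        by (simp add: power2_eq_square algebra_simps)
      moreover have "1 + norm z \<noteq> 0"
        using norm_ge_zero[of z] by linarith
      ultimately show ?thesis by (simp add: power2_eq_square)
    qed
    also have "\<dots> \<le> (1 - (norm z)\<^sup>2) / (norm (\<zeta> - z))\<^sup>2"
      using \<zeta> z norm_triangle_ineq4[of \<zeta> z]
      by (intro frac_le power_mono) (auto simp: power_le_one)
    finally show "poisson_kernel 0 \<zeta> * ((1 - norm z) / 2) \<le> poisson_kernel z \<zeta>"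
      using \<zeta> by (simp add: poisson_kernel_def)
  qed
  then show ?thesis
    using clark_measure_eq[OF \<tau>(1)] z by simp
qed

text \<open>Write \<psi>(r \<eta>) = \<beta> + t q with t = 1 - r, so that q tends to -D \<eta>. As
  cnj \<beta> D \<eta> = |D|, expanding the square shows that (1 - |\<psi>|^2) / t tends to 2 |D|.
  Dividing by |q|^2 gives the weighted Clark quotient, whose limit is therefore 2 / |D|; by
  \<open>clark_atom_radial_limit\<close> it is also twice the mass.\<close>

lemma clark_atom_eq:
  fixes F :: "complex \<Rightarrow> complex"
  assumes clark: "\<And>\<beta>. \<beta> \<in> circle \<Longrightarrow> is_clark_measure \<psi> \<beta> (\<tau> \<beta>)"
    and \<psi>: "\<And>z. norm z < 1 \<Longrightarrow> norm (\<psi> z) < 1"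
    and F: "\<And>z. z \<in> disc \<Longrightarrow> F z = \<psi> z" "F \<eta> = \<beta>"
    and der: "(F has_field_derivative D) (at \<eta> within cball 0 1 - E)"
    and E: "E \<subseteq> circle" and \<eta>: "\<eta> \<in> circle" and \<beta>: "\<beta> \<in> circle"
  shows "D \<noteq> 0" "measure (\<tau> \<beta>) {\<eta>} = 1 / norm D"
proof -
  have fin: "finite_measure (\<tau> \<beta>')" if "\<beta>' \<in> circle" for \<beta>'
    using clark_measure_finite[OF clark] that \<psi> by simp
  define t where "t n = 1 / (real n + 2)" for n
  define r where "r n = 1 - t n" for n
  define q where "q n = (\<psi> (of_real (r n) * \<eta>) - \<beta>) / of_real (t n)" for n
  have t: "t n > 0" and r01: "0 \<le> r n" "r n < 1" for n
    by (auto simp: t_def r_def)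
  have t0: "t \<longlonglongrightarrow> 0" unfolding t_def by real_asymp
  then have r1: "r \<longlonglongrightarrow> 1"
    unfolding r_def using tendsto_diff[OF tendsto_const[of 1] t0] by simp
  have in_disc: "of_real (r n) * \<eta> \<in> disc" for n
    using r01 \<eta> by (simp add: norm_mult)
  have at0: "filterlim t (at_right 0) sequentially"
    unfolding filterlim_at using t0 t by (auto intro!: always_eventually less_imp_neq[symmetric])
  have q: "q \<longlonglongrightarrow> - (D * \<eta>)"
  proof -
    have eq: "\<eta> * (1 - of_real (t n) * 1) = of_real (r n) * \<eta>" for n
      by (simp add: r_def mult.commute)
    have "(\<lambda>n. (F (\<eta> * (1 - of_real (t n) * 1)) - F \<eta>) / of_real (t n)) \<longlonglongrightarrow> - (D * \<eta> * 1)"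
      by (rule filterlim_compose[OF boundary_difference_quotient(1)[OF der E \<eta>] at0]) simp
    then show ?thesis
      unfolding eq q_def using F in_disc by simp
  qed
  have \<psi>q: "\<psi> (of_real (r n) * \<eta>) = \<beta> + of_real (t n) * q n" for n
    using t[of n] by (simp add: q_def)
  have numerator: "(1 - (norm (\<psi> (of_real (r n) * \<eta>)))\<^sup>2) / t n = - 2 * Re (cnj \<beta> * q n) - t n * (norm (q n))\<^sup>2" for n
  proof -
    have "(norm (\<beta> + of_real (t n) * q n))\<^sup>2 = (norm \<beta>)\<^sup>2 + t n * (2 * Re (cnj \<beta> * q n) + t n * (norm (q n))\<^sup>2)"
      unfolding cmod_power2 by (simp add: power2_eq_square algebra_simps)
    then show ?thesis
      unfolding \<psi>q using \<beta> t[of n] by (simp add: field_simps)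
  qed
  have num_lim: "(\<lambda>n. (1 - (norm (\<psi> (of_real (r n) * \<eta>)))\<^sup>2) / t n) \<longlonglongrightarrow> 2 * norm D"
  proof -
    have real: "cnj \<beta> * D * \<eta> = of_real (norm D)"
      by (rule boundary_derivative_real[OF der E \<eta> _ F(2) \<beta>]) (use F \<psi> in auto)
    have "(\<lambda>n. - 2 * Re (cnj \<beta> * q n) - t n * (norm (q n))\<^sup>2) \<longlonglongrightarrow>
        - 2 * Re (cnj \<beta> * - (D * \<eta>)) - 0 * (norm (- (D * \<eta>)))\<^sup>2"
      by (intro tendsto_intros q t0)
    also have "- 2 * Re (cnj \<beta> * - (D * \<eta>)) - 0 * (norm (- (D * \<eta>)))\<^sup>2 = 2 * Re (cnj \<beta> * D * \<eta>)"
      by (simp add: mult.assoc)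
    finally show ?thesis
      unfolding numerator real by simp
  qed
  show "D \<noteq> 0"
  proof
    assume "D = 0"
    \<comment> \<open>The quotient for -\<beta> has a denominator that stays away from 0 near
      \<eta>, so Harnack's inequality bounds (1 - |\<psi>|^2) / t from below. In the limit 2 c \<le>
      2 |D|, since |-\<beta> - \<beta>|^2 = 4.\<close>
    have \<beta>': "- \<beta> \<in> circle" using \<beta> by simp
    define c where "c = (1 - (norm (\<psi> 0))\<^sup>2) / (norm (- \<beta> - \<psi> 0))\<^sup>2"
    have "c > 0"
      unfolding c_def using \<beta>' \<psi>[of 0] by (intro clark_quotient_pos) auto
    have "c / 2 * (norm (- \<beta> - \<psi> (of_real (r n) * \<eta>)))\<^sup>2 \<le> (1 - (norm (\<psi> (of_real (r n) * \<eta>)))\<^sup>2) / t n" for n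
    proof -
      let ?z = "of_real (r n) * \<eta>"
      have "c * ((1 - norm ?z) / 2) \<le> (1 - (norm (\<psi> ?z))\<^sup>2) / (norm (- \<beta> - \<psi> ?z))\<^sup>2"
        unfolding c_def by (rule clark_measure_harnack[OF clark[OF \<beta>'] fin[OF \<beta>'] in_disc])
      moreover have "norm ?z = r n"
        unfolding norm_mult norm_of_real using \<eta> r01[of n] by simp
      then have "1 - norm ?z = t n"
        by (simp only: r_def)
      ultimately have "c * (t n / 2) \<le> (1 - (norm (\<psi> ?z))\<^sup>2) / (norm (- \<beta> - \<psi> ?z))\<^sup>2"
        by (simp only:)
      moreover have "norm (\<psi> ?z) < norm (- \<beta>)"
        using \<psi>[of ?z] in_disc[of n] \<beta>' by simp
      then have "- \<beta> - \<psi> ?z \<noteq> 0"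
        by (metis eq_iff_diff_eq_0 less_irrefl)
      then have "0 < (norm (- \<beta> - \<psi> ?z))\<^sup>2" by simp
      ultimately show ?thesis
        using t[of n] by (simp add: field_simps)
    qed
    moreover have "(\<lambda>n. \<psi> (of_real (r n) * \<eta>)) \<longlonglongrightarrow> \<beta> + of_real 0 * - (D * \<eta>)"
      unfolding \<psi>q by (intro tendsto_intros t0 q)
    then have "(\<lambda>n. c / 2 * (norm (- \<beta> - \<psi> (of_real (r n) * \<eta>)))\<^sup>2) \<longlonglongrightarrow> c / 2 * (norm (- \<beta> - \<beta>))\<^sup>2"
      by (intro tendsto_intros) simp
    ultimately have "c / 2 * (norm (- \<beta> - \<beta>))\<^sup>2 \<le> 2 * norm D"
      by (intro LIMSEQ_le[OF _ num_lim]) auto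
    moreover have "- \<beta> - \<beta> \<noteq> 0"
      using \<beta> by (auto simp: eq_neg_iff_add_eq_0 simp flip: mult_2)
    ultimately show False
      using \<open>D = 0\<close> \<open>c > 0\<close> by (simp add: mult_le_0_iff)
  qed
  have "(\<lambda>n. (1 - (norm (\<psi> (of_real (r n) * \<eta>)))\<^sup>2) / t n / (norm (q n))\<^sup>2) \<longlonglongrightarrow>
      2 * norm D / (norm (- (D * \<eta>)))\<^sup>2"
    by (intro tendsto_intros num_lim q) (use \<open>D \<noteq> 0\<close> \<eta> in auto)
  moreover have "(1 - (norm (\<psi> (of_real (r n) * \<eta>)))\<^sup>2) / t n / (norm (q n))\<^sup>2 =
      (1 - r n) * ((1 - (norm (\<psi> (of_real (r n) * \<eta>)))\<^sup>2) / (norm (\<beta> - \<psi> (of_real (r n) * \<eta>)))\<^sup>2)" for n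
    using t[of n] by (simp add: q_def r_def norm_divide norm_minus_commute power_divide power2_eq_square)
  ultimately have "2 * measure (\<tau> \<beta>) {\<eta>} = 2 * norm D / (norm (- (D * \<eta>)))\<^sup>2"
    using clark_atom_radial_limit[OF clark[OF \<beta>] fin[OF \<beta>] \<eta> r1 r01] by (simp add: LIMSEQ_unique)
  then show "measure (\<tau> \<beta>) {\<eta>} = 1 / norm D"
    using \<eta> \<open>D \<noteq> 0\<close> by (simp add: norm_mult power2_eq_square)
qed

section \<open>Boundary data of \<psi> from its extension\<close>

lemma nontangential_tendsto_of_extension:
  assumes "E \<subseteq> circle" "(f \<longlongrightarrow> l) (at \<eta> within cball 0 1 - E)"
  shows "(f \<longlongrightarrow> l) (nontangential \<eta>)"
proof (rule tendsto_mono[OF order_trans[OF nontangential_le_disc at_le] assms(2)])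
  show "disc \<subseteq> cball 0 1 - E" using assms(1) by auto
qed

text \<open>\<open>F\<close> is tied to \<psi> only inside the disc. Since \<open>E\<close> lies on
  the circle, limits within the domain of \<open>F\<close> restrict to nontangential ones, and
  uniqueness of those limits identifies the value and the derivative of \<open>F\<close> with the
  boundary data of \<psi>.\<close>

lemma boundary_solution_of_extension:
  assumes E: "E \<subseteq> circle" and F: "\<And>z. z \<in> disc \<Longrightarrow> F z = \<psi> z"
    and der: "(F has_field_derivative D) (at \<eta> within cball 0 1 - E)"
    and sol: "\<eta> \<in> boundary_solutions \<psi> \<beta>"
  shows "F \<eta> = \<beta>" "angular_deriv \<psi> \<eta> = D"
proof -
  have \<eta>: "\<eta> \<in> circle" and lim: "(\<psi> \<longlongrightarrow> \<beta>) (nontangential \<eta>)"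
    using sol by (auto simp: boundary_solutions_def)
  have disc: "\<forall>\<^sub>F z in nontangential \<eta>. z \<in> disc"
    using nontangential_le_disc by (rule filter_leD) (auto simp: eventually_at_filter)
  have "(F \<longlongrightarrow> F \<eta>) (nontangential \<eta>)"
    using has_field_derivative_imp_has_derivative[OF der, THEN has_derivative_continuous]
    by (intro nontangential_tendsto_of_extension[OF E]) (simp add: continuous_within)
  then have "(\<psi> \<longlongrightarrow> F \<eta>) (nontangential \<eta>)"
    by (rule Lim_transform_eventually) (use disc F in \<open>auto elim: eventually_mono\<close>)
  then show F\<eta>: "F \<eta> = \<beta>"
    using lim nontangential_neq_bot[OF \<eta>] by (rule tendsto_unique[rotated])
  have "((\<lambda>z. (F z - F \<eta>) / (z - \<eta>)) \<longlongrightarrow> D) (nontangential \<eta>)"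
    using der unfolding has_field_derivative_iff by (rule nontangential_tendsto_of_extension[OF E])
  then have "((\<lambda>z. (\<psi> z - boundary_value \<psi> \<eta>) / (z - \<eta>)) \<longlongrightarrow> D) (nontangential \<eta>)"
    unfolding boundary_value_eqI[OF \<eta> lim] F\<eta>
    by (rule Lim_transform_eventually) (use disc F in \<open>auto elim: eventually_mono\<close>)
  then show "angular_deriv \<psi> \<eta> = D"
    unfolding angular_deriv_def by (intro tendsto_Lim nontangential_neq_bot[OF \<eta>])
qed

section \<open>Uniqueness for Poisson integrals on the torus\<close>

definition scale_pair :: "real \<Rightarrow> complex \<times> complex \<Rightarrow> complex \<times> complex" where
  "scale_pair r \<xi> = (of_real r * fst \<xi>, of_real r * snd \<xi>)"

lemma scale_pair_in_disc:
  "\<xi> \<in> circle \<times> circle \<Longrightarrow> 0 \<le> r \<Longrightarrow> r < 1 \<Longrightarrow> scale_pair r \<xi> \<in> disc \<times> disc"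
  by (auto simp: scale_pair_def norm_mult)

text \<open>For unimodular points |\<zeta> - r \<xi>| = |\<xi> - r \<zeta>|. This symmetry lets
  Fubini move the Poisson smoothing from a measure to the test function.\<close>

lemma poisson_kernel_swap:
  assumes "\<xi> \<in> circle" "\<zeta> \<in> circle"
  shows "poisson_kernel (of_real r * \<xi>) \<zeta> = poisson_kernel (of_real r * \<zeta>) \<xi>"
proof -
  have "(norm (\<zeta> - of_real r * \<xi>))\<^sup>2 = (norm \<zeta>)\<^sup>2 + r\<^sup>2 * (norm \<xi>)\<^sup>2 - 2 * r * (Re \<zeta> * Re \<xi> + Im \<zeta> * Im \<xi>)" for \<xi> \<zeta>
    unfolding cmod_power2 by (simp add: power2_eq_square algebra_simps)
  then show ?thesis
    using assms by (simp add: poisson_kernel_def norm_mult mult.commute)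
qed

lemma poisson_kernel2_swap:
  "\<xi> \<in> circle \<times> circle \<Longrightarrow> \<zeta> \<in> circle \<times> circle \<Longrightarrow>
    poisson_kernel2 (scale_pair r \<xi>) \<zeta> = poisson_kernel2 (scale_pair r \<zeta>) \<xi>"
  by (auto simp: poisson_kernel2_def scale_pair_def poisson_kernel_swap)

section \<open>Poisson kernels on the torus as an approximate identity\<close>

lemma continuous_on_poisson_kernel2:
  assumes "z \<in> disc \<times> disc"
  shows "continuous_on (circle \<times> circle) (poisson_kernel2 z)"
proof -
  have "continuous_on (circle \<times> circle) (\<lambda>\<zeta>. poisson_kernel (fst z) (fst \<zeta>))"
    by (rule continuous_on_compose2[OF continuous_on_poisson_kernel])
      (use assms in \<open>auto intro!: continuous_intros\<close>)
  moreover have "continuous_on (circle \<times> circle) (\<lambda>\<zeta>. poisson_kernel (snd z) (snd \<zeta>))"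
    by (rule continuous_on_compose2[OF continuous_on_poisson_kernel])
      (use assms in \<open>auto intro!: continuous_intros\<close>)
  ultimately show ?thesis
    unfolding poisson_kernel2_def by (rule continuous_on_mult)
qed

lemma continuous_on_poisson_kernel2_scale_pair:
  assumes "0 \<le> r" "r < 1"
  shows "continuous_on ((circle \<times> circle) \<times> (circle \<times> circle)) (\<lambda>x. poisson_kernel2 (scale_pair r (fst x)) (snd x))"
proof -
  have "\<zeta> \<noteq> of_real r * \<xi>" if "norm \<zeta> = 1" "norm \<xi> = 1" for \<zeta> \<xi> :: complex
    using that assms by (auto simp: norm_mult)
  then show ?thesis
    unfolding poisson_kernel2_def poisson_kernel_def scale_pair_def by (auto intro!: continuous_intros)
qed

lemma poisson_kernel2_nonneg: "z \<in> disc \<times> disc \<Longrightarrow> 0 \<le> poisson_kernel2 z \<zeta>"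
  unfolding poisson_kernel2_def by (intro mult_nonneg_nonneg poisson_kernel_nonneg) auto

text \<open>On the circle |\<zeta> - \<xi>|^2 = 2 - 2 Re (cnj \<xi> \<zeta>). The function cnj \<xi>
  \<zeta> is holomorphic in \<zeta>, so its Poisson integral at r \<xi> is its value there, namely
  r.\<close>

lemma integral_poisson_kernel_deviation:
  assumes \<xi>: "\<xi> \<in> circle" and r: "0 \<le> r" "r < 1"
  shows "(LINT \<zeta>|arc_measure. poisson_kernel (of_real r * \<xi>) \<zeta> * (norm (\<zeta> - \<xi>))\<^sup>2) = 2 * (1 - r)"
proof -
  define z where "z = of_real r * \<xi>"
  have z: "z \<in> disc" using r \<xi> by (simp add: z_def norm_mult)
  note P = continuous_on_poisson_kernel[OF z]
  have "(LINT \<zeta>|arc_measure. poisson_kernel z \<zeta> * (norm (\<zeta> - \<xi>))\<^sup>2) =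
      (LINT \<zeta>|arc_measure. 2 * poisson_kernel z \<zeta> - 2 * Re (of_real (poisson_kernel z \<zeta>) * (cnj \<xi> * \<zeta>)))"
  proof (rule Bochner_Integration.integral_cong)
    fix \<zeta> assume "\<zeta> \<in> space arc_measure"
    define R where "R = Re (cnj \<xi> * \<zeta>)"
    have "(norm (\<zeta> - \<xi>))\<^sup>2 = (norm \<zeta>)\<^sup>2 + (norm \<xi>)\<^sup>2 - 2 * R"
      unfolding cmod_power2 R_def by (simp add: power2_eq_square algebra_simps)
    with \<open>\<zeta> \<in> space arc_measure\<close> \<xi> have "(norm (\<zeta> - \<xi>))\<^sup>2 = 2 - 2 * R"
      by simp
    moreover have "Re (of_real (poisson_kernel z \<zeta>) * (cnj \<xi> * \<zeta>)) = poisson_kernel z \<zeta> * R"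
      unfolding R_def by (simp only: times_complex.sel Re_complex_of_real Im_complex_of_real mult_zero_left diff_zero)
    ultimately show "poisson_kernel z \<zeta> * (norm (\<zeta> - \<xi>))\<^sup>2 =
        2 * poisson_kernel z \<zeta> - 2 * Re (of_real (poisson_kernel z \<zeta>) * (cnj \<xi> * \<zeta>))"
      by (simp only: right_diff_distrib)
  qed simp
  also have "\<dots> = 2 * (LINT \<zeta>|arc_measure. poisson_kernel z \<zeta>) -
      2 * Re (LINT \<zeta>|arc_measure. of_real (poisson_kernel z \<zeta>) * (cnj \<xi> * \<zeta>))"
  proof -
    have "integrable arc_measure (\<lambda>\<zeta>. of_real (poisson_kernel z \<zeta>) * (cnj \<xi> * \<zeta>))"
      by (intro continuous_on_imp_integrable_arc continuous_intros P)
    moreover have "integrable arc_measure (poisson_kernel z)"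
      by (rule continuous_on_imp_integrable_arc[OF P])
    ultimately show ?thesis
      by (simp only: Bochner_Integration.integral_diff integral_mult_right_zero integral_Re
          integrable_mult_right integrable_Re)
  qed
  also have "\<dots> = 2 * (1 - Re (cnj \<xi> * z))"
    using integral_poisson_kernel[OF z] poisson_integral_continuous[of "\<lambda>u. cnj \<xi> * u", OF _ _ z]
    by (simp add: continuous_intros holomorphic_intros)
  also have "cnj \<xi> * z = of_real r"
    using \<xi> by (simp add: z_def mult.left_commute mult.commute[of "cnj \<xi>"] flip: complex_norm_square)
  finally show ?thesis by (simp add: z_def)
qed

abbreviation torus_measure :: "(complex \<times> complex) measure" where
  "torus_measure \<equiv> arc_measure \<Otimes>\<^sub>M arc_measure"

interpretation torus: compact_borel_measure torus_measure
  by (intro compact_borel_measure_pair arc.compact_borel_measure_axioms)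

lemma space_torus_measure [simp]: "space torus_measure = circle \<times> circle"
  by (simp add: space_pair_measure)

lemma integral_torus_product:
  fixes a b :: "complex \<Rightarrow> real"
  assumes "continuous_on circle a" "continuous_on circle b"
  shows "(LINT \<zeta>|torus_measure. a (fst \<zeta>) * b (snd \<zeta>)) =
    (LINT \<zeta>|arc_measure. a \<zeta>) * (LINT \<zeta>|arc_measure. b \<zeta>)"
proof -
  have "continuous_on (circle \<times> circle) (\<lambda>\<zeta>. a (fst \<zeta>) * b (snd \<zeta>))"
    by (intro continuous_intros continuous_on_compose2[OF assms(1)] continuous_on_compose2[OF assms(2)]) auto
  then show ?thesis
    using Fubini_continuous_compact(1)[OF arc.compact_borel_measure_axioms arc.compact_borel_measure_axioms,
        of "\<lambda>x y. a x * b y"]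
    by simp
qed

text \<open>Korovkin's argument: only the deviation of the kernel from \<open>\<xi>\<close> in quadratic mean matters.\<close>

lemma poisson_kernel2_approximation:
  fixes f :: "complex \<times> complex \<Rightarrow> complex"
  assumes f: "continuous_on (circle \<times> circle) f" and \<xi>: "\<xi> \<in> circle \<times> circle"
    and r: "r \<longlonglongrightarrow> 1" "\<And>n. 0 \<le> r n" "\<And>n. r n < 1"
  shows "(\<lambda>n. LINT \<zeta>|torus_measure. of_real (poisson_kernel2 (scale_pair (r n) \<xi>) \<zeta>) * f \<zeta>) \<longlonglongrightarrow> f \<xi>"
proof -
  define P where "P n = poisson_kernel2 (scale_pair (r n) \<xi>)" for n
  define d where "d \<zeta> = (norm (fst \<zeta> - fst \<xi>))\<^sup>2 + (norm (snd \<zeta> - snd \<xi>))\<^sup>2" for \<zeta>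
  have in_disc: "scale_pair (r n) \<xi> \<in> disc \<times> disc" for n
    by (rule scale_pair_in_disc[OF \<xi> r(2,3)])
  have P_cont: "continuous_on (circle \<times> circle) (P n)" for n
    unfolding P_def by (rule continuous_on_poisson_kernel2[OF in_disc])
  have P_nonneg: "0 \<le> P n \<zeta>" for n \<zeta>
    unfolding P_def by (rule poisson_kernel2_nonneg[OF in_disc])
  have d_cont: "continuous_on (circle \<times> circle) d"
    unfolding d_def by (intro continuous_intros)
  have z1: "of_real (r n) * fst \<xi> \<in> disc" and z2: "of_real (r n) * snd \<xi> \<in> disc" for n
    using in_disc[of n] by (auto simp: scale_pair_def)
  have P1: "(LINT \<zeta>|torus_measure. P n \<zeta>) = 1" for n
    unfolding P_def poisson_kernel2_def scale_pair_def fst_conv snd_conv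
    by (subst integral_torus_product) (use z1 z2 in \<open>auto simp: integral_poisson_kernel intro: continuous_on_poisson_kernel\<close>)
  \<comment> \<open>Each coordinate contributes 2 (1 - r), the kernel of the other coordinate
    integrating to 1.\<close>
  have Pd: "(LINT \<zeta>|torus_measure. P n \<zeta> * d \<zeta>) = 4 * (1 - r n)" for n
  proof -
    let ?p = "poisson_kernel (of_real (r n) * fst \<xi>)" and ?q = "poisson_kernel (of_real (r n) * snd \<xi>)"
    let ?x = "\<lambda>\<zeta>. (norm (\<zeta> - fst \<xi>))\<^sup>2" and ?y = "\<lambda>\<zeta>. (norm (\<zeta> - snd \<xi>))\<^sup>2"
    have c: "continuous_on circle ?p" "continuous_on circle ?q"
      using z1 z2 by (auto intro: continuous_on_poisson_kernel)
    have c2: "continuous_on (circle \<times> circle) (\<lambda>\<zeta>. ?p (fst \<zeta>))" "continuous_on (circle \<times> circle) (\<lambda>\<zeta>. ?q (snd \<zeta>))"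
      by (rule continuous_on_compose2[OF c(1)] continuous_on_compose2[OF c(2)]; auto intro!: continuous_intros)+
    have "(LINT \<zeta>|torus_measure. P n \<zeta> * d \<zeta>) =
        (LINT \<zeta>|torus_measure. (?p (fst \<zeta>) * ?x (fst \<zeta>)) * ?q (snd \<zeta>) + ?p (fst \<zeta>) * (?q (snd \<zeta>) * ?y (snd \<zeta>)))"
      by (rule Bochner_Integration.integral_cong)
        (auto simp: P_def poisson_kernel2_def scale_pair_def d_def algebra_simps)
    also have "\<dots> = (LINT \<zeta>|torus_measure. (?p (fst \<zeta>) * ?x (fst \<zeta>)) * ?q (snd \<zeta>)) +
        (LINT \<zeta>|torus_measure. ?p (fst \<zeta>) * (?q (snd \<zeta>) * ?y (snd \<zeta>)))"
      by (rule Bochner_Integration.integral_add; rule torus.continuous_on_imp_integrable)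
        (auto intro!: continuous_intros c2)
    also have "(LINT \<zeta>|torus_measure. (?p (fst \<zeta>) * ?x (fst \<zeta>)) * ?q (snd \<zeta>)) =
        (LINT \<zeta>|arc_measure. ?p \<zeta> * ?x \<zeta>) * (LINT \<zeta>|arc_measure. ?q \<zeta>)"
      by (rule integral_torus_product) (intro continuous_intros c)+
    also have "\<dots> = 2 * (1 - r n)"
      using \<xi> r(2,3) z2 by (subst integral_poisson_kernel_deviation) (auto simp: integral_poisson_kernel)
    also have "(LINT \<zeta>|torus_measure. ?p (fst \<zeta>) * (?q (snd \<zeta>) * ?y (snd \<zeta>))) =
        (LINT \<zeta>|arc_measure. ?p \<zeta>) * (LINT \<zeta>|arc_measure. ?q \<zeta> * ?y \<zeta>)"
      by (rule integral_torus_product) (intro continuous_intros c)+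
    also have "\<dots> = 2 * (1 - r n)"
      using \<xi> r(2,3) z1 by (subst integral_poisson_kernel_deviation) (auto simp: integral_poisson_kernel)
    finally show ?thesis by simp
  qed
  have int_f: "integrable torus_measure (\<lambda>\<zeta>. of_real (P n \<zeta>) * f \<zeta>)"
    and int_c: "integrable torus_measure (\<lambda>\<zeta>. of_real (P n \<zeta>) * f \<xi>)"
    and int_d: "integrable torus_measure (\<lambda>\<zeta>. P n \<zeta> * d \<zeta>)"
    and int_P: "integrable torus_measure (P n)" for n
    by (rule torus.continuous_on_imp_integrable; simp; intro continuous_intros P_cont f d_cont)+
  have compact: "compact (circle \<times> circle :: (complex \<times> complex) set)"
    by (intro compact_Times) auto
  obtain M where M: "\<And>\<zeta>. \<zeta> \<in> circle \<times> circle \<Longrightarrow> norm (f \<zeta>) \<le> M"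
    using compact_imp_bounded[OF compact_continuous_image[OF f compact]] unfolding bounded_iff by blast
  have close: "\<exists>C\<ge>0. \<forall>\<zeta>\<in>circle \<times> circle. norm (f \<zeta> - f \<xi>) \<le> e + C * d \<zeta>" if e: "e > 0" for e
  proof -
    obtain \<delta> where \<delta>: "\<delta> > 0" "\<And>\<zeta>. \<zeta> \<in> circle \<times> circle \<Longrightarrow> dist \<zeta> \<xi> < \<delta> \<Longrightarrow> dist (f \<zeta>) (f \<xi>) < e"
      using f \<xi> e unfolding continuous_on_iff by blast
    have "0 \<le> M"
      using M[OF \<xi>] norm_ge_zero order_trans by blast
    have d_dist: "d \<zeta> = (dist \<zeta> \<xi>)\<^sup>2" for \<zeta>
      by (simp add: d_def dist_prod_def dist_norm)
    \<comment> \<open>Near \<xi> continuity gives e. Further away \<open>d \<zeta>\<close> is at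
      least \<delta>^2, so the second term already exceeds the trivial bound 2 M.\<close>
    have "norm (f \<zeta> - f \<xi>) \<le> e + 2 * M / \<delta>\<^sup>2 * d \<zeta>" if \<zeta>: "\<zeta> \<in> circle \<times> circle" for \<zeta>
    proof (cases "dist \<zeta> \<xi> < \<delta>")
      case True
      have "0 \<le> 2 * M / \<delta>\<^sup>2 * d \<zeta>"
        using \<open>0 \<le> M\<close> by (simp add: d_def)
      with \<delta>(2)[OF \<zeta> True] show ?thesis by (simp add: dist_norm)
    next
      case False
      then have "\<delta>\<^sup>2 \<le> d \<zeta>"
        using \<delta>(1) unfolding d_dist by (intro power_mono) auto
      then have "2 * M / \<delta>\<^sup>2 * \<delta>\<^sup>2 \<le> 2 * M / \<delta>\<^sup>2 * d \<zeta>"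
        using \<open>0 \<le> M\<close> by (intro mult_left_mono) auto
      moreover have "norm (f \<zeta> - f \<xi>) \<le> 2 * M"
        using norm_triangle_ineq4[of "f \<zeta>" "f \<xi>"] M[OF \<zeta>] M[OF \<xi>] by linarith
      ultimately show ?thesis
        using \<delta>(1) e by simp
    qed
    with \<open>0 \<le> M\<close> show ?thesis
      by (intro exI[of _ "2 * M / \<delta>\<^sup>2"]) auto
  qed
  have bound: "norm ((LINT \<zeta>|torus_measure. of_real (P n \<zeta>) * f \<zeta>) - f \<xi>) \<le> e + C * (4 * (1 - r n))"
    if C: "\<And>\<zeta>. \<zeta> \<in> circle \<times> circle \<Longrightarrow> norm (f \<zeta> - f \<xi>) \<le> e + C * d \<zeta>" for n e C
  proof -
    have "f \<xi> = (LINT \<zeta>|torus_measure. of_real (P n \<zeta>) * f \<xi>)"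
      by (simp add: P1)
    then have "norm ((LINT \<zeta>|torus_measure. of_real (P n \<zeta>) * f \<zeta>) - f \<xi>) =
        norm (LINT \<zeta>|torus_measure. of_real (P n \<zeta>) * f \<zeta> - of_real (P n \<zeta>) * f \<xi>)"
      by (simp only: Bochner_Integration.integral_diff[OF int_f int_c])
    also have "\<dots> \<le> (LINT \<zeta>|torus_measure. P n \<zeta> * e + C * (P n \<zeta> * d \<zeta>))"
    proof (rule Bochner_Integration.integral_norm_bound_integral)
      show "integrable torus_measure (\<lambda>\<zeta>. of_real (P n \<zeta>) * f \<zeta> - of_real (P n \<zeta>) * f \<xi>)"
        by (rule Bochner_Integration.integrable_diff[OF int_f int_c])
      show "integrable torus_measure (\<lambda>\<zeta>. P n \<zeta> * e + C * (P n \<zeta> * d \<zeta>))"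
        by (intro Bochner_Integration.integrable_add integrable_mult_left integrable_mult_right int_P int_d)
      fix \<zeta> assume "\<zeta> \<in> space torus_measure"
      then have "P n \<zeta> * norm (f \<zeta> - f \<xi>) \<le> P n \<zeta> * (e + C * d \<zeta>)"
        by (intro mult_left_mono C P_nonneg) simp
      moreover have "norm (of_real (P n \<zeta>) * f \<zeta> - of_real (P n \<zeta>) * f \<xi>) = P n \<zeta> * norm (f \<zeta> - f \<xi>)"
        using P_nonneg[of n \<zeta>] unfolding right_diff_distrib[symmetric] norm_mult by simp
      ultimately show "norm (of_real (P n \<zeta>) * f \<zeta> - of_real (P n \<zeta>) * f \<xi>) \<le> P n \<zeta> * e + C * (P n \<zeta> * d \<zeta>)"
        by (simp add: algebra_simps)
    qed
    also have "\<dots> = e + C * (4 * (1 - r n))"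
      by (simp add: Bochner_Integration.integral_add int_P int_d P1 Pd)
    finally show ?thesis .
  qed
  have "(\<lambda>n. LINT \<zeta>|torus_measure. of_real (P n \<zeta>) * f \<zeta>) \<longlonglongrightarrow> f \<xi>"
  proof (rule tendstoI)
    fix e :: real assume "e > 0"
    then obtain C where C: "\<forall>\<zeta>\<in>circle \<times> circle. norm (f \<zeta> - f \<xi>) \<le> e / 2 + C * d \<zeta>"
      using close[of "e / 2"] by auto
    have "(\<lambda>n. e / 2 + C * (4 * (1 - r n))) \<longlonglongrightarrow> e / 2 + C * (4 * (1 - 1))"
      by (intro tendsto_intros r)
    from order_tendstoD(2)[OF this, of e] \<open>e > 0\<close>
    have "\<forall>\<^sub>F n in sequentially. e / 2 + C * (4 * (1 - r n)) < e"
      by simp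
    then show "\<forall>\<^sub>F n in sequentially. dist (LINT \<zeta>|torus_measure. of_real (P n \<zeta>) * f \<zeta>) (f \<xi>) < e"
      by eventually_elim (use bound[of "e / 2" C] C in \<open>force simp: dist_norm intro: le_less_trans\<close>)
  qed
  then show ?thesis by (simp add: P_def)
qed

text \<open>By symmetry of the kernel and Fubini, the left side is the \<open>M\<close>-integral of
  the Poisson means of \<open>f\<close>, which are bounded by sup |f| and converge pointwise to
  \<open>f\<close>. The left side sees \<open>M\<close> only through its Poisson integrals, and this
  gives uniqueness.\<close>

lemma integral_tendsto_poisson_means:
  fixes f :: "complex \<times> complex \<Rightarrow> complex"
  assumes M: "compact_borel_measure M" "space M = circle \<times> circle"
    and f: "continuous_on (circle \<times> circle) f"
    and r: "r \<longlonglongrightarrow> 1" "\<And>n. 0 \<le> r n" "\<And>n. r n < 1"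
  shows "(\<lambda>n. LINT \<zeta>|torus_measure. f \<zeta> * of_real (LINT \<xi>|M. poisson_kernel2 (scale_pair (r n) \<zeta>) \<xi>))
    \<longlonglongrightarrow> (LINT \<xi>|M. f \<xi>)"
proof -
  interpret M: compact_borel_measure M by fact
  define h where "h n \<xi> \<zeta> = of_real (poisson_kernel2 (scale_pair (r n) \<xi>) \<zeta>) * f \<zeta>" for n \<xi> \<zeta>
  have h_cont: "continuous_on (space M \<times> space torus_measure) (\<lambda>x. h n (fst x) (snd x))" for n
    unfolding h_def M(2) space_torus_measure
    by (intro continuous_intros continuous_on_poisson_kernel2_scale_pair r continuous_on_compose2[OF f]) auto
  have "(LINT \<zeta>|torus_measure. f \<zeta> * of_real (LINT \<xi>|M. poisson_kernel2 (scale_pair (r n) \<zeta>) \<xi>))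
      = (LINT \<xi>|M. LINT \<zeta>|torus_measure. h n \<xi> \<zeta>)" for n
  proof -
    have "(LINT \<xi>|M. LINT \<zeta>|torus_measure. h n \<xi> \<zeta>) = (LINT \<zeta>|torus_measure. LINT \<xi>|M. h n \<xi> \<zeta>)"
      by (rule Fubini_continuous_compact(2)[OF M(1) torus.compact_borel_measure_axioms h_cont])
    also have "\<dots> = (LINT \<zeta>|torus_measure. LINT \<xi>|M. f \<zeta> * of_real (poisson_kernel2 (scale_pair (r n) \<zeta>) \<xi>))"
      by (intro Bochner_Integration.integral_cong refl)
        (auto simp: h_def M(2) poisson_kernel2_swap)
    finally show ?thesis by simp
  qed
  moreover have "(\<lambda>n. LINT \<xi>|M. LINT \<zeta>|torus_measure. h n \<xi> \<zeta>) \<longlonglongrightarrow> (LINT \<xi>|M. f \<xi>)"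
  proof -
    have compact: "compact (circle \<times> circle :: (complex \<times> complex) set)"
      by (intro compact_Times) auto
    obtain B where B: "\<And>\<zeta>. \<zeta> \<in> circle \<times> circle \<Longrightarrow> norm (f \<zeta>) \<le> B"
      using compact_imp_bounded[OF compact_continuous_image[OF f compact]] unfolding bounded_iff by blast
    have int_h: "integrable torus_measure (h n \<xi>)" and h_le: "norm (LINT \<zeta>|torus_measure. h n \<xi> \<zeta>) \<le> B"
      if \<xi>: "\<xi> \<in> circle \<times> circle" for n \<xi>
    proof -
      have z: "scale_pair (r n) \<xi> \<in> disc \<times> disc"
        by (rule scale_pair_in_disc[OF \<xi> r(2,3)])
      let ?P = "poisson_kernel2 (scale_pair (r n) \<xi>)"
      note P = continuous_on_poisson_kernel2[OF z]
      show int: "integrable torus_measure (h n \<xi>)"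
        unfolding h_def by (rule torus.continuous_on_imp_integrable, simp) (intro continuous_intros P f)
      have "norm (LINT \<zeta>|torus_measure. h n \<xi> \<zeta>) \<le> (LINT \<zeta>|torus_measure. ?P \<zeta> * B)"
      proof (rule Bochner_Integration.integral_norm_bound_integral[OF int])
        show "integrable torus_measure (\<lambda>\<zeta>. ?P \<zeta> * B)"
          by (rule torus.continuous_on_imp_integrable, simp) (intro continuous_intros P)
        show "norm (h n \<xi> \<zeta>) \<le> ?P \<zeta> * B" if "\<zeta> \<in> space torus_measure" for \<zeta>
          using poisson_kernel2_nonneg[OF z, of \<zeta>] B[of \<zeta>] that by (simp add: h_def norm_mult mult_left_mono)
      qed
      also have "\<dots> = B * (LINT \<zeta>|torus_measure. ?P \<zeta>)" by simp
      also have "(LINT \<zeta>|torus_measure. ?P \<zeta>) = 1"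
        unfolding poisson_kernel2_def
        by (subst integral_torus_product)
          (use z in \<open>auto simp: integral_poisson_kernel intro: continuous_on_poisson_kernel\<close>)
      finally show "norm (LINT \<zeta>|torus_measure. h n \<xi> \<zeta>) \<le> B" by simp
    qed
    show ?thesis
    proof (rule integral_dominated_convergence)
      show "integrable M (\<lambda>_. B)" by simp
      show "f \<in> borel_measurable M"
        using f by (intro M.continuous_on_imp_measurable) (simp add: M(2))
      show "(\<lambda>\<xi>. LINT \<zeta>|torus_measure. h n \<xi> \<zeta>) \<in> borel_measurable M" for n
      proof -
        interpret MT: compact_borel_measure "M \<Otimes>\<^sub>M torus_measure"
          by (rule compact_borel_measure_pair[OF M(1) torus.compact_borel_measure_axioms])
        have "(\<lambda>x. h n (fst x) (snd x)) \<in> borel_measurable (M \<Otimes>\<^sub>M torus_measure)"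
          using h_cont by (intro MT.continuous_on_imp_measurable) (simp only: space_pair_measure)
        then show ?thesis
          by (intro torus.borel_measurable_lebesgue_integral) (simp add: case_prod_beta')
      qed
      show "AE \<xi> in M. (\<lambda>n. LINT \<zeta>|torus_measure. h n \<xi> \<zeta>) \<longlonglongrightarrow> f \<xi>"
        using poisson_kernel2_approximation[OF f _ r] by (intro AE_I2) (simp add: h_def M(2))
      show "AE \<xi> in M. norm (LINT \<zeta>|torus_measure. h n \<xi> \<zeta>) \<le> B" for n
        using h_le by (intro AE_I2) (simp add: M(2))
    qed
  qed
  ultimately show ?thesis by simp
qed

lemma integral_eq_if_poisson_integrals_eq:
  fixes f :: "complex \<times> complex \<Rightarrow> complex"
  assumes M: "compact_borel_measure M" "space M = circle \<times> circle"
    and N: "compact_borel_measure N" "space N = circle \<times> circle"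
    and eq: "\<And>z. z \<in> disc \<times> disc \<Longrightarrow> (LINT \<xi>|M. poisson_kernel2 z \<xi>) = (LINT \<xi>|N. poisson_kernel2 z \<xi>)"
    and f: "continuous_on (circle \<times> circle) f"
  shows "(LINT \<xi>|M. f \<xi>) = (LINT \<xi>|N. f \<xi>)"
proof -
  define r where "r n = 1 - 1 / (real n + 2)" for n
  have r: "r \<longlonglongrightarrow> 1" "\<And>n. 0 \<le> r n" "\<And>n. r n < 1"
    using filterlim_at_left_1_sequentially by (auto simp: r_def[abs_def] filterlim_at)
  have "(LINT \<zeta>|torus_measure. f \<zeta> * of_real (LINT \<xi>|M. poisson_kernel2 (scale_pair (r n) \<zeta>) \<xi>)) =
      (LINT \<zeta>|torus_measure. f \<zeta> * of_real (LINT \<xi>|N. poisson_kernel2 (scale_pair (r n) \<zeta>) \<xi>))" for n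
    by (rule Bochner_Integration.integral_cong) (simp_all add: eq[OF scale_pair_in_disc[OF _ r(2,3)]])
  then show ?thesis
    using integral_tendsto_poisson_means[OF M f r] integral_tendsto_poisson_means[OF N f r]
    by (simp add: LIMSEQ_unique)
qed

section \<open>The Clark measure of the product\<close>

lemma measurable_circle_except_finite:
  fixes h :: "complex \<Rightarrow> 'a::real_normed_vector"
  assumes "finite E" "continuous_on (circle - E) h"
  shows "h \<in> borel_measurable (restrict_space borel circle)"
proof (rule measurable_discrete_difference[where X = "E \<inter> circle"])
  have "circle - E \<in> sets borel"
    by (intro sets.Diff borel_closed closed_sphere finite_imp_closed[OF assms(1)])
  then show "(\<lambda>x. indicator (circle - E) x *\<^sub>R h x) \<in> borel_measurable (restrict_space borel circle)"
    by (intro measurable_restrict_space1 borel_measurable_continuous_on_indicator assms(2))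
  show "{x} \<in> sets (restrict_space borel circle)" if "x \<in> E \<inter> circle" for x
    using that by (auto simp: sets_restrict_space intro!: image_eqI[of _ _ "{x}"])
qed (use assms(1) in \<open>auto simp: space_restrict_space intro: countable_finite\<close>)

lemma parametrizes_solutions_measurable:
  assumes "parametrizes_solutions \<psi> K g" "k \<in> K"
  shows "g k \<in> restrict_space borel circle \<rightarrow>\<^sub>M restrict_space borel circle"
proof (rule measurable_restrict_space2)
  obtain E where "finite E" "continuous_on (circle - E) (g k)"
    using assms by (auto simp: parametrizes_solutions_def)
  then show "g k \<in> borel_measurable (restrict_space borel circle)"
    by (rule measurable_circle_except_finite)
  have "g k \<beta> \<in> boundary_solutions \<psi> \<beta>" if "\<beta> \<in> circle" for \<beta>
    using assms that unfolding parametrizes_solutions_def by blast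
  then show "g k \<in> space (restrict_space borel circle) \<rightarrow> circle"
    by (auto simp: space_restrict_space boundary_solutions_def)
qed

text \<open>A boundary point solves the equation for at most one \<beta>, its nontangential
  limit.\<close>

lemma finite_boundary_solutions_values:
  assumes "finite E"
  shows "finite {\<beta>. \<exists>\<eta>\<in>E. \<eta> \<in> boundary_solutions \<psi> \<beta>}"
proof -
  have "\<beta> = boundary_value \<psi> \<eta>" if "\<eta> \<in> boundary_solutions \<psi> \<beta>" for \<beta> \<eta>
    using that boundary_value_eqI by (fastforce simp: boundary_solutions_def)
  then have "{\<beta>. \<exists>\<eta>\<in>E. \<eta> \<in> boundary_solutions \<psi> \<beta>} \<subseteq> boundary_value \<psi> ` E"
    by auto
  then show ?thesis
    by (rule finite_subset) (use assms in simp)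
qed

text \<open>The exceptional values are those attained at the singular points of \<open>\<psi>\<close>, where the
  Lim defining the angular derivative may be meaningless, and those at which branches meet.\<close>

lemma clark_measure_branch_expansion:
  assumes \<psi>: "\<And>z. norm z < 1 \<Longrightarrow> norm (\<psi> z) < 1"
    and A: "C1_on_circle_except_finite \<psi>" and B: "parametrizes_solutions \<psi> K g"
    and clark: "\<And>\<beta>. \<beta> \<in> circle \<Longrightarrow> is_clark_measure \<psi> \<beta> (\<tau> \<beta>)"
    and D: "\<And>\<beta>. \<beta> \<in> circle \<Longrightarrow> discrete_measure (\<tau> \<beta>)"
  obtains N w where "finite N"
    and "\<And>k. k \<in> K \<Longrightarrow> w k \<in> borel_measurable (restrict_space borel circle)"
    and "\<And>k \<beta>. k \<in> K \<Longrightarrow> \<beta> \<in> circle - N \<Longrightarrow> w k \<beta> = 1 / norm (angular_deriv \<psi> (g k \<beta>))"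
    and "\<And>k \<beta>. 0 \<le> w k \<beta>"
    and "\<And>\<beta> z. \<beta> \<in> circle - N \<Longrightarrow> z \<in> disc \<Longrightarrow>
      (\<integral>\<^sup>+k. ennreal (w k \<beta> * poisson_kernel z (g k \<beta>)) \<partial>count_space K) =
      ennreal ((1 - (norm (\<psi> z))\<^sup>2) / (norm (\<beta> - \<psi> z))\<^sup>2)"
proof -
  obtain E F F' where E: "finite E" "E \<subseteq> circle" and F: "\<And>z. z \<in> disc \<Longrightarrow> F z = \<psi> z"
    and der: "\<And>z. z \<in> cball 0 1 - E \<Longrightarrow> (F has_field_derivative F' z) (at z within cball 0 1 - E)"
    and F': "continuous_on (cball 0 1 - E) F'"
    using A unfolding C1_on_circle_except_finite_def by blast
  obtain N0 where N0: "finite N0" "\<And>\<beta>. \<beta> \<in> circle - N0 \<Longrightarrow> inj_on (\<lambda>k. g k \<beta>) K"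
    using B unfolding parametrizes_solutions_def by blast
  have sol: "(\<lambda>k. g k \<beta>) ` K = boundary_solutions \<psi> \<beta>" if "\<beta> \<in> circle" for \<beta>
    using B that unfolding parametrizes_solutions_def by blast
  define N where "N = N0 \<union> {\<beta>. \<exists>\<eta>\<in>E. \<eta> \<in> boundary_solutions \<psi> \<beta>}"
  \<comment> \<open>The weight uses the continuous \<open>F'\<close>, so that composition with a
    branch is visibly measurable; outside \<open>N\<close> it agrees with the weight formed from
    \<open>angular_deriv\<close>.\<close>
  define w where "w k \<beta> = 1 / norm (F' (g k \<beta>))" for k \<beta>
  have w_nonneg: "0 \<le> w k \<beta>" for k \<beta>
    by (simp add: w_def)
  have "finite N"
    unfolding N_def using N0(1) finite_boundary_solutions_values[OF E(1)] by simp
  have regular: "\<eta> \<in> circle - E" if "\<beta> \<in> circle - N" "\<eta> \<in> boundary_solutions \<psi> \<beta>" for \<beta> \<eta>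
    using that by (auto simp: N_def boundary_solutions_def)
  have derivative: "angular_deriv \<psi> \<eta> = F' \<eta>" "F' \<eta> \<noteq> 0" "measure (\<tau> \<beta>) {\<eta>} = 1 / norm (F' \<eta>)"
    if \<beta>: "\<beta> \<in> circle - N" and \<eta>: "\<eta> \<in> boundary_solutions \<psi> \<beta>" for \<beta> \<eta>
  proof -
    have \<eta>E: "\<eta> \<in> cball 0 1 - E" "\<eta> \<in> circle"
      using regular[OF \<beta> \<eta>] by auto
    note d = der[OF \<eta>E(1)]
    note ext = boundary_solution_of_extension[OF E(2) F d \<eta>]
    show "angular_deriv \<psi> \<eta> = F' \<eta>" by (rule ext(2))
    have \<beta>c: "\<beta> \<in> circle" using \<beta> by simp
    show "F' \<eta> \<noteq> 0" "measure (\<tau> \<beta>) {\<eta>} = 1 / norm (F' \<eta>)"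
      by (rule clark_atom_eq[OF clark \<psi> F ext(1) d E(2) \<eta>E(2) \<beta>c]; assumption)+
  qed
  have branch: "g k \<beta> \<in> boundary_solutions \<psi> \<beta>" if "k \<in> K" "\<beta> \<in> circle" for k \<beta>
    using sol[OF that(2)] that(1) by blast
  have "w k \<in> borel_measurable (restrict_space borel circle)" if k: "k \<in> K" for k
  proof -
    obtain Ek where Ek: "finite Ek" "continuous_on (circle - Ek) (g k)"
      using B k unfolding parametrizes_solutions_def by blast
    have "continuous_on (circle - (N \<union> Ek)) (\<lambda>\<beta>. F' (g k \<beta>))"
    proof (rule continuous_on_compose2[OF F'])
      show "continuous_on (circle - (N \<union> Ek)) (g k)"
        by (rule continuous_on_subset[OF Ek(2)]) auto
      show "g k ` (circle - (N \<union> Ek)) \<subseteq> cball 0 1 - E"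
        using regular branch[OF k] by fastforce
    qed
    then have "continuous_on (circle - (N \<union> Ek)) (w k)"
      unfolding w_def by (intro continuous_intros) (use derivative(2) branch[OF k] in auto)
    then show ?thesis
      using \<open>finite N\<close> Ek(1) by (intro measurable_circle_except_finite[of "N \<union> Ek"]) auto
  qed
  moreover have "w k \<beta> = 1 / norm (angular_deriv \<psi> (g k \<beta>))" if "k \<in> K" "\<beta> \<in> circle - N" for k \<beta>
    using derivative(1)[OF that(2)] branch[OF that(1)] that(2) by (simp add: w_def)
  moreover have "(\<integral>\<^sup>+k. ennreal (w k \<beta> * poisson_kernel z (g k \<beta>)) \<partial>count_space K) =
      ennreal ((1 - (norm (\<psi> z))\<^sup>2) / (norm (\<beta> - \<psi> z))\<^sup>2)" if \<beta>: "\<beta> \<in> circle - N" and z: "z \<in> disc" for \<beta> z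
  proof -
    have \<beta>c: "\<beta> \<in> circle" using \<beta> by simp
    note ts = clark_measure_sets[OF clark[OF \<beta>c]]
    have fin: "finite_measure (\<tau> \<beta>)"
      using clark_measure_finite[OF clark[OF \<beta>c]] \<psi> \<beta>c by simp
    interpret finite_measure "\<tau> \<beta>" by (rule fin)
    have int: "integrable (\<tau> \<beta>) (poisson_kernel z)"
      by (rule poisson_kernel_integrable[OF ts(2) fin z])
    have "ennreal ((1 - (norm (\<psi> z))\<^sup>2) / (norm (\<beta> - \<psi> z))\<^sup>2) = (\<integral>\<^sup>+x. ennreal (poisson_kernel z x) \<partial>\<tau> \<beta>)"
      using nn_integral_eq_integral[OF int] poisson_kernel_nonneg[OF z] clark_measure_eq[OF clark[OF \<beta>c] z]
      by simp
    also have "\<dots> = (\<integral>\<^sup>+x. emeasure (\<tau> \<beta>) {x} * ennreal (poisson_kernel z x) \<partial>count_space (space (\<tau> \<beta>)))"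
    proof (rule nn_integral_discrete_measure[OF D[OF \<beta>c]])
      show "{x} \<in> sets (\<tau> \<beta>)" if "x \<in> space (\<tau> \<beta>)" for x
        using that by (auto simp: ts sets_restrict_space intro!: image_eqI[of _ _ "{x}"])
      show "(\<lambda>x. ennreal (poisson_kernel z x)) \<in> borel_measurable (\<tau> \<beta>)"
        using int by measurable
    qed
    \<comment> \<open>Points that are not solutions carry no atom, by
      \<open>clark_atom_imp_boundary_solution\<close>.\<close>
    also have "\<dots> = (\<integral>\<^sup>+x. emeasure (\<tau> \<beta>) {x} * ennreal (poisson_kernel z x) \<partial>count_space (boundary_solutions \<psi> \<beta>))"
    proof (rule nn_integral_count_space_eq)
      fix x assume "x \<in> space (\<tau> \<beta>) - boundary_solutions \<psi> \<beta>"
      then have "\<not> 0 < measure (\<tau> \<beta>) {x}"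
        using clark_atom_imp_boundary_solution[OF clark[OF \<beta>c] fin \<psi> \<beta>c, of x] ts(1) by auto
      then have "measure (\<tau> \<beta>) {x} = 0"
        using measure_nonneg[of "\<tau> \<beta>" "{x}"] by linarith
      then show "emeasure (\<tau> \<beta>) {x} * ennreal (poisson_kernel z x) = 0"
        by (simp add: emeasure_eq_measure)
    qed (auto simp: ts boundary_solutions_def)
    \<comment> \<open>Outside \<open>N\<close> the branches are pairwise distinct, so they enumerate
      the solutions bijectively and every atom is counted once.\<close>
    also have "\<dots> = (\<integral>\<^sup>+k. emeasure (\<tau> \<beta>) {g k \<beta>} * ennreal (poisson_kernel z (g k \<beta>)) \<partial>count_space K)"
      using N0(2)[of \<beta>] \<beta> sol[OF \<beta>c]
      by (intro nn_integral_bij_count_space[symmetric]) (auto simp: bij_betw_def N_def)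
    also have "\<dots> = (\<integral>\<^sup>+k. ennreal (w k \<beta> * poisson_kernel z (g k \<beta>)) \<partial>count_space K)"
    proof (rule nn_integral_cong)
      fix k assume "k \<in> space (count_space K)"
      then have "measure (\<tau> \<beta>) {g k \<beta>} = w k \<beta>"
        using derivative(3)[OF \<beta>] branch \<beta>c by (simp add: w_def)
      then show "emeasure (\<tau> \<beta>) {g k \<beta>} * ennreal (poisson_kernel z (g k \<beta>)) =
          ennreal (w k \<beta> * poisson_kernel z (g k \<beta>))"
        using poisson_kernel_nonneg[OF z] w_nonneg by (simp add: emeasure_eq_measure flip: ennreal_mult)
    qed
    finally show ?thesis ..
  qed
  ultimately show ?thesis
    using w_nonneg by (intro that[of N w] \<open>finite N\<close>)
qed

text \<open>This makes the quotient accessible to the Poisson formula, as the real part of an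
  expression holomorphic in v. For v = a both sides are divisions by zero and equal 0.\<close>

lemma poisson_quotient_eq_Re:
  fixes a v :: complex
  assumes "norm a = 1"
  shows "Re ((a + v) / (a - v)) = (1 - (norm v)\<^sup>2) / (norm (a - v))\<^sup>2"
proof -
  have "(a + v) / (a - v) = ((a + v) * cnj (a - v)) / of_real ((norm (a - v))\<^sup>2)"
    by (cases "a = v") (simp_all only: complex_norm_square, auto)
  moreover have "Re ((a + v) * cnj (a - v)) = (norm a)\<^sup>2 - (norm v)\<^sup>2"
    unfolding cmod_power2 by (simp add: power2_eq_square algebra_simps)
  ultimately show ?thesis
    using assms by (simp only: Re_divide_of_real) simp
qed

text \<open>As \<open>b \<zeta>\<close> is unimodular, |\<alpha> - b c| = |\<alpha> cnj b - c|. The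
  integrand is therefore the kernel times the real part of G(b) for the Moebius map \<open>G\<close>
  below, whose pole lies outside the closed disc because |c| < 1, and the integral is Re
  G(\<phi>(z)).\<close>

lemma nn_integral_poisson_product_inner:
  assumes \<phi>: "inner_function \<phi>" and b: "b \<in> borel_measurable arc_measure" "\<And>\<zeta>. norm (b \<zeta>) = 1"
    and lim: "AE \<zeta> in arc_measure. (\<phi> \<longlongrightarrow> b \<zeta>) (nontangential \<zeta>)"
    and \<alpha>: "\<alpha> \<in> circle" and z: "z \<in> disc" and c: "c \<in> disc"
  shows "(\<integral>\<^sup>+\<zeta>. ennreal (poisson_kernel z \<zeta> * ((1 - (norm c)\<^sup>2) / (norm (\<alpha> * cnj (b \<zeta>) - c))\<^sup>2)) \<partial>arc_measure) =
    ennreal ((1 - (norm (\<phi> z * c))\<^sup>2) / (norm (\<alpha> - \<phi> z * c))\<^sup>2)"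
proof -
  define G where "G w = (\<alpha> + w * c) / (\<alpha> - w * c)" for w
  have nz: "\<alpha> - w * c \<noteq> 0" if "norm w \<le> 1" for w
  proof
    assume "\<alpha> - w * c = 0"
    then have "norm (w * c) = 1" using \<alpha> by auto
    moreover have "norm (w * c) \<le> 1 * norm c"
      unfolding norm_mult using that by (intro mult_right_mono) auto
    ultimately show False using c by simp
  qed
  have G: "continuous_on (cball 0 1) G" "G holomorphic_on disc"
    unfolding G_def using nz by (auto intro!: continuous_intros holomorphic_intros)
  note PG = poisson_integral_inner_compose[OF \<phi> b lim G z]
  have ReG: "Re (of_real (poisson_kernel z \<zeta>) * G (b \<zeta>)) =
      poisson_kernel z \<zeta> * ((1 - (norm c)\<^sup>2) / (norm (\<alpha> * cnj (b \<zeta>) - c))\<^sup>2)" for \<zeta>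
  proof -
    have "b \<zeta> * cnj (b \<zeta>) = 1"
      using b(2)[of \<zeta>] by (simp flip: complex_norm_square)
    then have "\<alpha> - b \<zeta> * c = b \<zeta> * (\<alpha> * cnj (b \<zeta>) - c)"
      by (simp add: right_diff_distrib mult.left_commute)
    then have "norm (\<alpha> - b \<zeta> * c) = norm (\<alpha> * cnj (b \<zeta>) - c)"
      by (simp add: norm_mult b(2))
    then have "Re (G (b \<zeta>)) = (1 - (norm c)\<^sup>2) / (norm (\<alpha> * cnj (b \<zeta>) - c))\<^sup>2"
      unfolding G_def using \<alpha> by (subst poisson_quotient_eq_Re) (auto simp: norm_mult b(2))
    then show ?thesis
      by (simp only: times_complex.sel Re_complex_of_real Im_complex_of_real mult_zero_left diff_zero)
  qed
  have "(\<integral>\<^sup>+\<zeta>. ennreal (poisson_kernel z \<zeta> * ((1 - (norm c)\<^sup>2) / (norm (\<alpha> * cnj (b \<zeta>) - c))\<^sup>2)) \<partial>arc_measure)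
      = ennreal (LINT \<zeta>|arc_measure. Re (of_real (poisson_kernel z \<zeta>) * G (b \<zeta>)))"
    unfolding ReG[symmetric]
  proof (rule nn_integral_eq_integral)
    show "integrable arc_measure (\<lambda>\<zeta>. Re (of_real (poisson_kernel z \<zeta>) * G (b \<zeta>)))"
      by (rule integrable_Re[OF PG(2)])
    show "AE \<zeta> in arc_measure. 0 \<le> Re (of_real (poisson_kernel z \<zeta>) * G (b \<zeta>))"
      unfolding ReG using poisson_kernel_nonneg[OF z] c by (intro AE_I2) (auto simp: power_le_one)
  qed
  also have "(LINT \<zeta>|arc_measure. Re (of_real (poisson_kernel z \<zeta>) * G (b \<zeta>))) = Re (G (\<phi> z))"
    using integral_Re[OF PG(2)] PG(1) by simp
  also have "\<dots> = (1 - (norm (\<phi> z * c))\<^sup>2) / (norm (\<alpha> - \<phi> z * c))\<^sup>2"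
    unfolding G_def using \<alpha> by (intro poisson_quotient_eq_Re) simp
  finally show ?thesis .
qed

section \<open>Passage to the completion and to unordered sums\<close>

lemma borel_measurable_completion_AE:
  assumes f0: "f0 \<in> borel_measurable M" and ae: "AE x in M. f x = f0 x"
  shows "f \<in> borel_measurable (completion M)"
proof (rule measurableI)
  fix A :: "'b set" assume "A \<in> sets borel"
  have "AE x in completion M. x \<in> f0 -` A \<inter> space M \<longleftrightarrow> x \<in> f -` A \<inter> space (completion M)"
    using AE_completion[OF ae] by eventually_elim auto
  moreover have "f0 -` A \<inter> space M \<in> sets (completion M)"
    using f0 \<open>A \<in> sets borel\<close> by (intro sets_completionI_sets measurable_sets)
  ultimately show "f -` A \<inter> space (completion M) \<in> sets (completion M)"
    by (rule completion.in_sets_AE) auto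
qed simp

text \<open>On an exceptional null set the integrand of the theorem is built from unspecified values
  of \<open>Lim\<close>. In the completion it still inherits measurability and integral from a Borel
  function that agrees with it almost everywhere.\<close>

lemma
  fixes f :: "'a \<Rightarrow> 'b::{banach, second_countable_topology}"
  assumes f0: "integrable M f0" and ae: "AE x in M. f x = f0 x"
  shows integrable_completion_AE: "integrable (completion M) f"
    and integral_completion_AE: "integral\<^sup>L (completion M) f = integral\<^sup>L M f0"
proof -
  have f0m: "f0 \<in> borel_measurable M"
    using f0 by (rule borel_measurable_integrable)
  have fm: "f \<in> borel_measurable (completion M)"
    by (rule borel_measurable_completion_AE[OF f0m ae])
  have ae': "AE x in completion M. f x = f0 x"
    by (rule AE_completion[OF ae])
  show "integrable (completion M) f"
    using integrable_cong_AE[OF fm measurable_completion[OF f0m] ae'] integrable_completion[OF f0m] f0 by simp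
  show "integral\<^sup>L (completion M) f = integral\<^sup>L M f0"
    using integral_cong_AE[OF fm measurable_completion[OF f0m] ae'] integral_completion[OF f0m] by simp
qed

text \<open>Integrability for counting measure is absolute summability, which gives convergence
  independent of any order of the branches.\<close>

lemma has_sum_integral_count_space:
  fixes h :: "'a \<Rightarrow> complex"
  assumes "integrable (count_space A) h"
  shows "(h has_sum (LINT x|count_space A. h x)) A"
proof -
  have "Infinite_Set_Sum.abs_summable_on h A"
    using assms by (simp add: Infinite_Set_Sum.abs_summable_on_def)
  then have "(h has_sum infsum h A) A" "infsetsum h A = infsum h A"
    by (auto simp: infsetsum_infsum abs_summable_equivalent[symmetric] intro!: has_sum_infsum abs_summable_summable)
  then show ?thesis
    by (simp add: infsetsum_def)
qed

theorem theorem5p1: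
  fixes \<phi> \<psi> :: "complex \<Rightarrow> complex"
    and K :: "nat set" and g :: "nat \<Rightarrow> complex \<Rightarrow> complex"
    and \<tau> :: "complex \<Rightarrow> complex measure"
    and \<alpha> :: complex and \<sigma> :: "(complex \<times> complex) measure"
    and f :: "complex \<times> complex \<Rightarrow> complex"
  assumes "inner_function \<phi>" and "inner_function \<psi>"
    and A: "C1_on_circle_except_finite \<psi>"
    and B: "parametrizes_solutions \<psi> K g"
    and C: "\<And>\<beta> \<eta>. \<beta> \<in> circle \<Longrightarrow> \<eta> \<in> boundary_solutions \<psi> \<beta> \<Longrightarrow> \<not> infinite_multiplicity K g \<beta> \<eta>"
    and clark_\<psi>: "\<And>\<beta>. \<beta> \<in> circle \<Longrightarrow> is_clark_measure \<psi> \<beta> (\<tau> \<beta>)"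
    and D: "\<And>\<beta>. \<beta> \<in> circle \<Longrightarrow> discrete_measure (\<tau> \<beta>)"
    and "\<alpha> \<in> circle"
    and clark_\<Psi>: "is_clark_measure2 (\<lambda>z. \<phi> (fst z) * \<psi> (snd z)) \<alpha> \<sigma>"
    and "continuous_on (circle \<times> circle) f"
  shows "(\<forall>k\<in>K. integrable circle_measure
            (\<lambda>\<zeta>. f (\<zeta>, g k (\<alpha> * cnj (boundary_value \<phi> \<zeta>))) /
                  of_real (norm (angular_deriv \<psi> (g k (\<alpha> * cnj (boundary_value \<phi> \<zeta>))))))) \<and>
         ((\<lambda>k. LINT \<zeta>|circle_measure.
            f (\<zeta>, g k (\<alpha> * cnj (boundary_value \<phi> \<zeta>))) /
            of_real (norm (angular_deriv \<psi> (g k (\<alpha> * cnj (boundary_value \<phi> \<zeta>))))))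
          has_sum (LINT \<xi>|\<sigma>. f \<xi>)) K"
proof -
  note \<phi> = \<open>inner_function \<phi>\<close> and \<psi> = inner_function_norm_less[OF \<open>inner_function \<psi>\<close>]
    and \<alpha> = \<open>\<alpha> \<in> circle\<close> and f = \<open>continuous_on (circle \<times> circle) f\<close>
  define T where "T = restrict_space borel (circle \<times> circle :: (complex \<times> complex) set)"
  have space_T: "space T = circle \<times> circle"
    by (simp add: T_def space_restrict_space)
  have compact_torus: "compact (circle \<times> circle :: (complex \<times> complex) set)"
    by (intro compact_Times) auto
  have meas_T: "h \<in> borel_measurable T" if "continuous_on (circle \<times> circle) h" for h :: "_ \<Rightarrow> 'c::topological_space"
    unfolding T_def by (rule borel_measurable_continuous_on_restrict[OF that])

  obtain b where b: "b \<in> borel_measurable arc_measure" "\<And>\<zeta>. norm (b \<zeta>) = 1"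
    and lim: "AE \<zeta> in arc_measure. (\<phi> \<longlongrightarrow> b \<zeta>) (nontangential \<zeta>)"
    using inner_function_boundary_representative[OF \<phi>] by blast
  obtain N w where N: "finite N"
    and w_meas: "\<And>k. k \<in> K \<Longrightarrow> w k \<in> borel_measurable (restrict_space borel circle)"
    and w_eq: "\<And>k \<beta>. k \<in> K \<Longrightarrow> \<beta> \<in> circle - N \<Longrightarrow> w k \<beta> = 1 / norm (angular_deriv \<psi> (g k \<beta>))"
    and w_nonneg: "\<And>k \<beta>. 0 \<le> w k \<beta>"
    and expansion: "\<And>\<beta> z. \<beta> \<in> circle - N \<Longrightarrow> z \<in> disc \<Longrightarrow>
      (\<integral>\<^sup>+k. ennreal (w k \<beta> * poisson_kernel z (g k \<beta>)) \<partial>count_space K) =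
      ennreal ((1 - (norm (\<psi> z))\<^sup>2) / (norm (\<beta> - \<psi> z))\<^sup>2)"
    using clark_measure_branch_expansion[OF \<psi> A B clark_\<psi> D] by blast

  define \<beta> where "\<beta> \<zeta> = \<alpha> * cnj (b \<zeta>)" for \<zeta>
  have \<beta>_circle: "\<beta> \<zeta> \<in> circle" for \<zeta>
    using \<alpha> b(2) by (simp add: \<beta>_def norm_mult)
  have \<beta>_meas: "\<beta> \<in> arc_measure \<rightarrow>\<^sub>M restrict_space borel circle"
  proof (rule measurable_restrict_space2)
    have "(\<lambda>w. \<alpha> * cnj w) \<in> borel_measurable borel"
      by (intro borel_measurable_continuous_onI continuous_intros)
    from measurable_compose[OF b(1) this] show "\<beta> \<in> borel_measurable arc_measure"
      by (simp add: \<beta>_def[abs_def])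
  qed (use \<beta>_circle in auto)
  have \<beta>_N: "AE \<zeta> in arc_measure. \<beta> \<zeta> \<in> circle - N"
  proof -
    \<comment> \<open>For x on the circle, \<open>\<beta> \<zeta> = x\<close> means
      \<open>b \<zeta> = \<alpha> * cnj x\<close>, a null level set of the boundary values of
      \<phi>.\<close>
    have "AE \<zeta> in arc_measure. \<beta> \<zeta> \<noteq> x" if "x \<in> N" for x
    proof (cases "x \<in> circle")
      case True
      then have "\<alpha> * cnj x \<in> circle" using \<alpha> by (simp add: norm_mult)
      from inner_function_boundary_neq[OF \<phi> b lim this] show ?thesis
      proof eventually_elim
        case (elim \<zeta>)
        have "\<alpha> * cnj (\<beta> \<zeta>) = b \<zeta>"
          using \<alpha> by (simp add: \<beta>_def mult.assoc[symmetric] flip: complex_norm_square)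
        with elim show ?case by auto
      qed
    next
      case False
      then show ?thesis using \<beta>_circle by auto
    qed
    then have "AE \<zeta> in arc_measure. \<forall>x\<in>N. \<beta> \<zeta> \<noteq> x"
      by (intro AE_finite_allI N)
    then show ?thesis
      by eventually_elim (use \<beta>_circle in auto)
  qed
  have g_meas: "(\<lambda>\<zeta>. g k (\<beta> \<zeta>)) \<in> arc_measure \<rightarrow>\<^sub>M restrict_space borel circle" if "k \<in> K" for k
    by (rule measurable_compose[OF \<beta>_meas parametrizes_solutions_measurable[OF B that]])
  have wb_meas: "(\<lambda>\<zeta>. w k (\<beta> \<zeta>)) \<in> borel_measurable arc_measure" if "k \<in> K" for k
    by (rule measurable_compose[OF \<beta>_meas w_meas[OF that]])

  \<comment> \<open>One product measure carries both the branch index and the point of the circle,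
    so exchanging sum and integral becomes an instance of Tonelli or Fubini.\<close>
  define Q where "Q = count_space K \<Otimes>\<^sub>M arc_measure"
  define W where "W x = w (fst x) (\<beta> (snd x))" for x
  define P where "P x = (snd x, g (fst x) (\<beta> (snd x)))" for x
  interpret K: sigma_finite_measure "count_space K"
    by (rule sigma_finite_measure_count_space_countable) simp
  interpret Q: pair_sigma_finite "count_space K" arc_measure ..
  have W_nonneg: "0 \<le> W x" for x
    by (simp add: W_def w_nonneg)
  have W_meas: "W \<in> borel_measurable Q"
    unfolding W_def[abs_def] Q_def by (rule measurable_pair_measure_countable1) (use wb_meas in auto)
  have P_meas: "P \<in> Q \<rightarrow>\<^sub>M T"
    unfolding Q_def
  proof (rule measurable_pair_measure_countable1)
    fix k assume k: "k \<in> K"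
    have g1: "(\<lambda>\<zeta>. g k (\<beta> \<zeta>)) \<in> borel_measurable arc_measure"
      by (rule measurable_compose[OF g_meas[OF k] measurable_restrict_space1]) simp
    have "(\<lambda>\<zeta>. (\<zeta>, g k (\<beta> \<zeta>))) \<in> borel_measurable arc_measure"
      using arc.id_borel_measurable g1 by (rule borel_measurable_Pair)
    moreover have "g k (\<beta> \<zeta>) \<in> circle" if "\<zeta> \<in> circle" for \<zeta>
      using measurable_space[OF g_meas[OF k], of \<zeta>] that by (simp add: space_restrict_space)
    ultimately show "(\<lambda>\<zeta>. P (k, \<zeta>)) \<in> arc_measure \<rightarrow>\<^sub>M T"
      unfolding T_def by (intro measurable_restrict_space2) (auto simp: P_def)
  qed simp
  \<comment> \<open>The right-hand side of the theorem as a measure: each branch places the weighted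
    arc measure on its graph over the first circle.\<close>
  define \<nu> where "\<nu> = distr (density Q (\<lambda>x. ennreal (W x))) T P"
  have sets_\<nu>: "sets \<nu> = sets (restrict_space borel (circle \<times> circle))"
    by (simp add: \<nu>_def T_def)

  have \<nu>_poisson: "(\<integral>\<^sup>+\<xi>. ennreal (poisson_kernel2 z \<xi>) \<partial>\<nu>) =
      ennreal ((1 - (norm (\<phi> (fst z) * \<psi> (snd z)))\<^sup>2) / (norm (\<alpha> - \<phi> (fst z) * \<psi> (snd z)))\<^sup>2)"
    if z: "z \<in> disc \<times> disc" for z
  proof -
    have z1: "fst z \<in> disc" and z2: "snd z \<in> disc" and c: "\<psi> (snd z) \<in> disc"
      using z \<psi> by auto
    have p2: "(\<lambda>\<xi>. ennreal (poisson_kernel2 z \<xi>)) \<in> borel_measurable T"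
      by (intro measurable_compose[OF meas_T[OF continuous_on_poisson_kernel2[OF z]]] measurable_ennreal)
    then have p2P: "(\<lambda>x. ennreal (poisson_kernel2 z (P x))) \<in> borel_measurable Q"
      by (rule measurable_compose[OF P_meas])
    have "(\<integral>\<^sup>+\<xi>. ennreal (poisson_kernel2 z \<xi>) \<partial>\<nu>) = (\<integral>\<^sup>+x. ennreal (W x) * ennreal (poisson_kernel2 z (P x)) \<partial>Q)"
      unfolding \<nu>_def using P_meas p2 p2P W_meas
      by (subst nn_integral_distr) (auto simp: nn_integral_density)
    also have "\<dots> = (\<integral>\<^sup>+\<zeta>. \<integral>\<^sup>+k. ennreal (W (k, \<zeta>)) * ennreal (poisson_kernel2 z (P (k, \<zeta>))) \<partial>count_space K \<partial>arc_measure)"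
      using p2P W_meas unfolding Q_def by (subst Q.nn_integral_snd) auto
    also have "\<dots> = (\<integral>\<^sup>+\<zeta>. ennreal (poisson_kernel (fst z) \<zeta> *
        ((1 - (norm (\<psi> (snd z)))\<^sup>2) / (norm (\<alpha> * cnj (b \<zeta>) - \<psi> (snd z)))\<^sup>2)) \<partial>arc_measure)"
    proof (rule nn_integral_cong_AE)
      show "AE \<zeta> in arc_measure.
          (\<integral>\<^sup>+k. ennreal (W (k, \<zeta>)) * ennreal (poisson_kernel2 z (P (k, \<zeta>))) \<partial>count_space K) =
          ennreal (poisson_kernel (fst z) \<zeta> *
            ((1 - (norm (\<psi> (snd z)))\<^sup>2) / (norm (\<alpha> * cnj (b \<zeta>) - \<psi> (snd z)))\<^sup>2))"
        using \<beta>_N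
      proof eventually_elim
        case (elim \<zeta>)
        have "(\<integral>\<^sup>+k. ennreal (W (k, \<zeta>)) * ennreal (poisson_kernel2 z (P (k, \<zeta>))) \<partial>count_space K) =
            (\<integral>\<^sup>+k. ennreal (poisson_kernel (fst z) \<zeta>) *
              ennreal (w k (\<beta> \<zeta>) * poisson_kernel (snd z) (g k (\<beta> \<zeta>))) \<partial>count_space K)"
          using poisson_kernel_nonneg[OF z1] poisson_kernel_nonneg[OF z2] w_nonneg
          by (intro nn_integral_cong)
            (simp add: W_def P_def poisson_kernel2_def mult.left_commute flip: ennreal_mult)
        also have "\<dots> = ennreal (poisson_kernel (fst z) \<zeta>) *
            (\<integral>\<^sup>+k. ennreal (w k (\<beta> \<zeta>) * poisson_kernel (snd z) (g k (\<beta> \<zeta>))) \<partial>count_space K)"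
          by (rule nn_integral_cmult) simp
        also have "\<dots> = ennreal (poisson_kernel (fst z) \<zeta> *
            ((1 - (norm (\<psi> (snd z)))\<^sup>2) / (norm (\<beta> \<zeta> - \<psi> (snd z)))\<^sup>2))"
          using poisson_kernel_nonneg[OF z1] c
          by (simp only: expansion[OF elim z2]) (subst ennreal_mult, auto simp: power_le_one)
        finally show ?case by (simp only: \<beta>_def)
      qed
    qed
    also have "\<dots> = ennreal ((1 - (norm (\<phi> (fst z) * \<psi> (snd z)))\<^sup>2) / (norm (\<alpha> - \<phi> (fst z) * \<psi> (snd z)))\<^sup>2)"
      by (rule nn_integral_poisson_product_inner[OF \<phi> b lim \<alpha> z1 c])
    finally show ?thesis .
  qed

  have prod_less: "norm (\<phi> (fst z) * \<psi> (snd z)) < 1" if "z \<in> disc \<times> disc" for z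
  proof -
    have "norm (\<phi> (fst z)) * norm (\<psi> (snd z)) < 1 * 1"
      using that inner_function_norm_less[OF \<phi>] \<psi> by (intro mult_strict_mono') auto
    then show ?thesis by (simp add: norm_mult)
  qed
  have zero: "(0, 0) \<in> disc \<times> (disc :: complex set)" by simp
  have P0: "poisson_kernel2 (0, 0) \<xi> = 1" if "\<xi> \<in> circle \<times> circle" for \<xi>
    using that by (auto simp: poisson_kernel2_def poisson_kernel_def)

  have \<nu>: "compact_borel_measure \<nu>" "space \<nu> = circle \<times> circle"
  proof -
    \<comment> \<open>At the origin the kernel is 1, so the Poisson identity gives the total
      mass.\<close>
    have "(\<integral>\<^sup>+\<xi>. ennreal (poisson_kernel2 (0, 0) \<xi>) \<partial>\<nu>) = (\<integral>\<^sup>+\<xi>. 1 \<partial>\<nu>)"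
      using P0 by (intro nn_integral_cong) (auto simp: \<nu>_def space_T)
    moreover have "(\<integral>\<^sup>+\<xi>. ennreal (poisson_kernel2 (0, 0) \<xi>) \<partial>\<nu>) \<noteq> \<infinity>"
      unfolding \<nu>_poisson[OF zero] by simp
    ultimately have "finite_measure \<nu>"
      by (intro finite_measureI) simp
    from compact_borel_measureI[OF this sets_\<nu> compact_torus]
    show "compact_borel_measure \<nu>" "space \<nu> = circle \<times> circle" .
  qed
  interpret \<nu>: compact_borel_measure \<nu> by (rule \<nu>(1))

  have sets_\<sigma>: "sets \<sigma> = sets (restrict_space borel (circle \<times> circle))"
    and \<sigma>_poisson: "\<And>z. z \<in> disc \<times> disc \<Longrightarrow> (LINT \<xi>|\<sigma>. poisson_kernel2 z \<xi>) =
      (1 - (norm (\<phi> (fst z) * \<psi> (snd z)))\<^sup>2) / (norm (\<alpha> - \<phi> (fst z) * \<psi> (snd z)))\<^sup>2"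
    using clark_\<Psi> unfolding is_clark_measure2_def by auto
  have \<sigma>: "compact_borel_measure \<sigma>" "space \<sigma> = circle \<times> circle"
  proof -
    have "space \<sigma> = circle \<times> circle"
      using clark_\<Psi> unfolding is_clark_measure2_def by simp
    then have "(LINT \<xi>|\<sigma>. (1::real)) = (LINT \<xi>|\<sigma>. poisson_kernel2 (0, 0) \<xi>)"
      using P0 by (intro Bochner_Integration.integral_cong) auto
    also have "\<dots> > 0"
      unfolding \<sigma>_poisson[OF zero] using clark_quotient_pos[OF prod_less[OF zero]] \<alpha> by simp
    finally have "finite_measure \<sigma>"
      by (intro integral_nonzero_imp_finite_measure) simp
    from compact_borel_measureI[OF this sets_\<sigma> compact_torus]
    show "compact_borel_measure \<sigma>" "space \<sigma> = circle \<times> circle" .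
  qed
  have "(LINT \<xi>|\<sigma>. f \<xi>) = (LINT \<xi>|\<nu>. f \<xi>)"
  proof (rule integral_eq_if_poisson_integrals_eq[OF \<sigma> \<nu> _ f])
    fix z :: "complex \<times> complex" assume z: "z \<in> disc \<times> disc"
    have "(LINT \<xi>|\<nu>. poisson_kernel2 z \<xi>) = enn2real (\<integral>\<^sup>+\<xi>. ennreal (poisson_kernel2 z \<xi>) \<partial>\<nu>)"
      using continuous_on_poisson_kernel2[OF z] poisson_kernel2_nonneg[OF z] \<nu>(2)
      by (intro integral_eq_nn_integral \<nu>.continuous_on_imp_measurable) auto
    also have "\<dots> = (LINT \<xi>|\<sigma>. poisson_kernel2 z \<xi>)"
      using prod_less[OF z] unfolding \<nu>_poisson[OF z] \<sigma>_poisson[OF z]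
      by (intro enn2real_ennreal divide_nonneg_nonneg) (auto simp: power_le_one)
    finally show "(LINT \<xi>|\<sigma>. poisson_kernel2 z \<xi>) = (LINT \<xi>|\<nu>. poisson_kernel2 z \<xi>)" ..
  qed

  define h where "h k \<zeta> = w k (\<beta> \<zeta>) *\<^sub>R f (\<zeta>, g k (\<beta> \<zeta>))" for k \<zeta>
  have fP_meas: "(\<lambda>x. f (P x)) \<in> borel_measurable Q"
    by (rule measurable_compose[OF P_meas meas_T[OF f]])
  \<comment> \<open>Since \<nu> is finite and \<open>f\<close> bounded, pulling back to
    \<open>Q\<close> yields at once integrability on each branch and absolute summability over the
    branches.\<close>
  have "integrable \<nu> f"
    using f by (intro \<nu>.continuous_on_imp_integrable) (simp add: \<nu>(2))
  then have "integrable (density Q (\<lambda>x. ennreal (W x))) (\<lambda>x. f (P x))"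
    unfolding \<nu>_def using P_meas meas_T[OF f] by (subst (asm) integrable_distr_eq) auto
  then have "integrable Q (\<lambda>x. W x *\<^sub>R f (P x))"
    using W_meas fP_meas W_nonneg by (subst (asm) integrable_density) auto
  then have int_h: "integrable (count_space K \<Otimes>\<^sub>M arc_measure) (case_prod h)"
    by (simp add: h_def W_def P_def Q_def case_prod_beta')
  have "(LINT \<xi>|\<nu>. f \<xi>) = (LINT x|density Q (\<lambda>x. ennreal (W x)). f (P x))"
    unfolding \<nu>_def using P_meas meas_T[OF f] by (intro integral_distr) auto
  also have "\<dots> = (LINT x|Q. W x *\<^sub>R f (P x))"
    using W_meas fP_meas W_nonneg by (intro integral_density) auto
  also have "\<dots> = (LINT x|(count_space K \<Otimes>\<^sub>M arc_measure). case_prod h x)"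
    by (simp add: h_def W_def P_def Q_def case_prod_beta')
  also have "\<dots> = (LINT k|count_space K. LINT \<zeta>|arc_measure. h k \<zeta>)"
    using Q.integral_fst[OF int_h] by simp
  finally have \<nu>_eq: "(LINT \<xi>|\<nu>. f \<xi>) = (LINT k|count_space K. LINT \<zeta>|arc_measure. h k \<zeta>)" .
  have sum_h: "((\<lambda>k. LINT \<zeta>|arc_measure. h k \<zeta>) has_sum (LINT \<xi>|\<sigma>. f \<xi>)) K"
    unfolding \<open>(LINT \<xi>|\<sigma>. f \<xi>) = (LINT \<xi>|\<nu>. f \<xi>)\<close> \<nu>_eq
    by (rule has_sum_integral_count_space[OF Q.integrable_fst[OF int_h]])
  \<comment> \<open>For counting measure, almost every index means every index.\<close>
  have h_int: "integrable arc_measure (h k)" if "k \<in> K" for k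
    using Q.AE_integrable_fst[OF int_h] that by (simp add: AE_count_space)

  define F where "F k \<zeta> = f (\<zeta>, g k (\<alpha> * cnj (boundary_value \<phi> \<zeta>))) /
      of_real (norm (angular_deriv \<psi> (g k (\<alpha> * cnj (boundary_value \<phi> \<zeta>)))))" for k \<zeta>
  have "AE \<zeta> in arc_measure. \<zeta> \<in> circle"
    using AE_space[of arc_measure] by simp
  \<comment> \<open>Two null sets are discarded: points where \<phi> does not tend to
    \<open>b \<zeta>\<close>, and points where \<open>\<beta> \<zeta>\<close> falls into
    \<open>N\<close>, so that \<open>w\<close> need not be the reciprocal angular
    derivative.\<close>
  with lim \<beta>_N have F_h: "AE \<zeta> in arc_measure. F k \<zeta> = h k \<zeta>" if "k \<in> K" for k
  proof eventually_elim
    case (elim \<zeta>)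
    have "\<alpha> * cnj (boundary_value \<phi> \<zeta>) = \<beta> \<zeta>"
      using boundary_value_eqI elim(1,3) by (simp add: \<beta>_def)
    then show ?case
      using w_eq[OF that elim(2)] by (simp add: F_def h_def scaleR_conv_of_real)
  qed
  have "integrable circle_measure (F k)" if "k \<in> K" for k
    unfolding circle_measure_eq by (rule integrable_completion_AE[OF h_int F_h]) (use that in auto)
  moreover have "(LINT \<zeta>|circle_measure. F k \<zeta>) = (LINT \<zeta>|arc_measure. h k \<zeta>)" if "k \<in> K" for k
    unfolding circle_measure_eq by (rule integral_completion_AE[OF h_int F_h]) (use that in auto)
  then have "((\<lambda>k. LINT \<zeta>|circle_measure. F k \<zeta>) has_sum (LINT \<xi>|\<sigma>. f \<xi>)) K"
    using sum_h by (simp cong: has_sum_cong)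
  ultimately show ?thesis
    by (simp add: F_def[abs_def])
qed

end
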